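(* If the graph $G(N)$ of a finite $K45$ pointed action model $(N,s)$ (with preconditions in $\Phi$) is a finite tree, then $(N,s)$ is a basic learning action.
   Context: Fix a set $A$ of agents, a set $P$ of atoms, and a set $\Phi$ of epistemic formulas over $P$ and $A$. An action model $N=\langle S,(\rightharpoonup_a)_{a\in A},pre\rangle$ is $K45$ if each $\rightharpoonup_a$ is transitive and Euclidean, $S5$ if each is reflexive, transitive and Euclidean. $\mathrm{FAct}(\Phi)$ is the set of pointed action models $(N,t)$ with $N$ finite and $K45$ and preconditions in $\Phi$. Bisimulation $\simeq$ is the usual back-and-forth relation over all agents with related events having $KD45$-equivalent preconditions; $(N,s)$, $(N',s')$ are $a$-bisimilar if each $a$-successor of $s$ is bisimilar to some $a$-successor of $s'$ and vice versa; $gr((N,s))=\{a:\exists t\ s\rightharpoonup_a t\}$. Basic learning programs $\mathrm{BLP}(\Phi)$ with attributes $group$, $pre$: $?\varphi$ ($\varphi\in\Phi$; $group=\emptyset$, $pre=\varphi$); $L_B(\alpha_1,\dots,\alpha_n)$ ($B\subseteq A$; $group=B\cup group(\alpha_1)$, $pre=pre(\alpha_1)$); $\alpha_1\cap\alpha_2$ (if $pre(\alpha_1)=pre(\alpha_2)$ and groups disjoint; $group$ the union, $pre=pre(\alpha_1)$); $\psi|_B\alpha_1$ ($\psi$ a formula, $B\subseteq group(\alpha_1)$; $group=B$, $pre=\psi$). Semantics $(N_\alpha,s_\alpha)$: $?\varphi$: one event, empty relations, precondition $\varphi$. $L_B(\alpha_1,\dots,\alpha_k)$ with disjoint models $(N_l,s_l)$: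 events $\{(s_l,1)\}_l\cup\bigcup_l S_l$; for $b\in B$, $(s_i,1)\rightharpoonup_b(s_j,1)$ iff $(N_i,s_i)$, $(N_j,s_j)$ are $b$-bisimilar; for $a\in gr((N_j,s_j))\setminus B$, $(s_j,1)\rightharpoonup_a t$ whenever $s_j\rightharpoonup^j_a t$; old relations kept; actual event $(s_1,1)$, $pre((s_l,1))=pre_l(s_l)$. $\alpha_1\cap\alpha_2$: new actual event $s$ with $pre(s)=pre(s_1)$ added to the disjoint union, and for $a\in group(\alpha_i)$, relations of $N_i$ kept and $s\rightharpoonup_a t$ whenever $s_i\rightharpoonup^i_a t$. $\psi|_B\alpha$: new actual event $s$ with $pre(s)=\psi$ added to $N_\alpha$, all old relations kept, and $s\rightharpoonup_b t$ whenever $b\in B$ and $s_\alpha\rightharpoonup_b t$. A pointed action model in $\mathrm{FAct}(\Phi)$ is a basic learning action if it is bisimilar to $(N_\alpha,s_\alpha)$ for some $\alpha\in\mathrm{BLP}(\Phi)$. Graph: an $S5$ submodel of $N$ is $\langle S',(\rightharpoonup_a|_{S'})_{a\in B},pre|_{S'}\rangle$ ($S'\subseteq S$, $B\subseteq A$) which is $S5$; connected if any two distinct states are mutually reachable; closed if $s\in S'$, $a\in B$, $s\rightharpoonup_a t$ imply $t\in S'$; ordered by inclusion of both $S'$ and $B$. With $M^i=\langle S^i,(\rightharpoonup^i_a)_{a\in B^i},pre^i\rangle$ the distinct maximal closed connected $S5$ submodels, $T(N)$ has events $\bigcup_i S^i\times\{i\}$, $(s,i)\rightharpoonup'_a(t,j)$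 iff ($i=j$ and $s\rightharpoonup^i_a t$) or ($i\ne j$, $a\notin B^i$, $a\in B^j$, $s\rightharpoonup_a t$), $pre'((s,i))=pre^i(s)$. $G(N)$ has nodes the $M^i$ and an edge $M^i\rightarrowtail M^j$ ($i\neq j$) iff $(s,i)\rightharpoonup'_a(t,j)$ in $T(N)$ for some $s,t,a$. *)

theory Defs
  imports Main
begin

section \<open>Epistemic formulas and KD45-equivalence\<close>

text \<open>The set of agents is the type \<open>'a\<close>, the set of atoms is the type \<open>'p\<close>; both are
  arbitrary (in particular possibly infinite).\<close>

datatype ('a, 'p) fm =
    Atom 'p
  | Neg "('a, 'p) fm"
  | Conj "('a, 'p) fm" "('a, 'p) fm"
  | Box 'a "('a, 'p) fm"

record ('w, 'a, 'p) kripke =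
  worlds :: "'w set"
  acc :: "'a \<Rightarrow> ('w \<times> 'w) set"
  val :: "'w \<Rightarrow> 'p set"

definition euclidean :: "('x \<times> 'x) set \<Rightarrow> bool" where
  "euclidean r \<longleftrightarrow> (\<forall>x y z. (x, y) \<in> r \<longrightarrow> (x, z) \<in> r \<longrightarrow> (y, z) \<in> r)"

definition KD45 :: "('w, 'a, 'p) kripke \<Rightarrow> bool" where
  "KD45 K \<longleftrightarrow> worlds K \<noteq> {} \<and>
     (\<forall>a. acc K a \<subseteq> worlds K \<times> worlds K \<and>
          (\<forall>w \<in> worlds K. \<exists>v. (w, v) \<in> acc K a) \<and>
          trans (acc K a) \<and> euclidean (acc K a))"

primrec holds :: "('w, 'a, 'p) kripke \<Rightarrow> 'w \<Rightarrow> ('a, 'p) fm \<Rightarrow> bool" where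
  "holds K w (Atom p) \<longleftrightarrow> p \<in> val K w"
| "holds K w (Neg \<phi>) \<longleftrightarrow> \<not> holds K w \<phi>"
| "holds K w (Conj \<phi> \<psi>) \<longleftrightarrow> holds K w \<phi> \<and> holds K w \<psi>"
| "holds K w (Box a \<phi>) \<longleftrightarrow> (\<forall>v. (w, v) \<in> acc K a \<longrightarrow> holds K v \<phi>)"

text \<open>Worlds have to be taken from some fixed type. Sets of formulas are enough: the lemma
  \<open>kd45_equiv_all_types\<close> below shows that the definition then yields equivalence in all KD45
  models over every type of worlds.\<close>

definition kd45_equiv :: "('a, 'p) fm \<Rightarrow> ('a, 'p) fm \<Rightarrow> bool" where
  "kd45_equiv \<phi> \<psi> \<longleftrightarrow>
     (\<forall>K :: (('a, 'p) fm set, 'a, 'p) kripke. KD45 K \<longrightarrow>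
        (\<forall>w \<in> worlds K. holds K w \<phi> \<longleftrightarrow> holds K w \<psi>))"

lemma kd45_equiv_all_types:
  fixes K :: "('w, 'a, 'p) kripke"
  assumes eq: "kd45_equiv \<phi> \<psi>" and K: "KD45 K" and w: "w \<in> worlds K"
  shows "holds K w \<phi> \<longleftrightarrow> holds K w \<psi>"
proof -
  define th where "th = (\<lambda>v. {\<chi>. holds K v \<chi>})"
  define C :: "(('a, 'p) fm set, 'a, 'p) kripke" where
    "C = \<lparr>worlds = th ` worlds K,
          acc = (\<lambda>a. {(X, Y). X \<in> th ` worlds K \<and> Y \<in> th ` worlds K \<and>
                        (\<forall>\<chi>. Box a \<chi> \<in> X \<longrightarrow> \<chi> \<in> Y)}),
          val = (\<lambda>X. {p. Atom p \<in> X})\<rparr>"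
  have in_th: "\<chi> \<in> th v \<longleftrightarrow> holds K v \<chi>" for \<chi> v
    by (simp add: th_def)
  have sub: "acc K a \<subseteq> worlds K \<times> worlds K"
    and ser: "v \<in> worlds K \<Longrightarrow> \<exists>u. (v, u) \<in> acc K a"
    and tr: "trans (acc K a)" and eu: "euclidean (acc K a)" for a v
    using K by (auto simp: KD45_def)
  have accC: "(X, Y) \<in> acc C a \<longleftrightarrow>
      X \<in> th ` worlds K \<and> Y \<in> th ` worlds K \<and> (\<forall>\<chi>. Box a \<chi> \<in> X \<longrightarrow> \<chi> \<in> Y)" for X Y a
    by (simp add: C_def)
  have worldsC: "worlds C = th ` worlds K"
    by (simp add: C_def)
  have step: "(th v, th u) \<in> acc C a" if "(v, u) \<in> acc K a" for v u a
  proof -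
    have "v \<in> worlds K" "u \<in> worlds K" using that sub[of a] by blast+
    then show ?thesis using that by (simp add: accC in_th)
  qed
  have four: "Box a (Box a \<chi>) \<in> th v" if "Box a \<chi> \<in> th v" for a \<chi> v
  proof -
    have "holds K u' \<chi>" if "(v, u) \<in> acc K a" "(u, u') \<in> acc K a" for u u'
      using transD[OF tr that] \<open>Box a \<chi> \<in> th v\<close> by (simp add: in_th)
    then show ?thesis by (simp add: in_th)
  qed
  have five: "Box a (Neg (Box a \<chi>)) \<in> th v" if "Box a \<chi> \<notin> th v" for a \<chi> v
  proof -
    have "\<exists>u. (v, u) \<in> acc K a \<and> \<not> holds K u \<chi>"
      using that by (simp add: in_th)
    then obtain u where u: "(v, u) \<in> acc K a" "\<not> holds K u \<chi>" by blast
    have "(u', u) \<in> acc K a" if "(v, u') \<in> acc K a" for u'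
      using eu[of a] u(1) that unfolding euclidean_def by blast
    then show ?thesis using u(2) by (auto simp: in_th)
  qed
  have kd: "KD45 C"
    unfolding KD45_def
  proof (intro conjI allI ballI)
    show "worlds C \<noteq> {}" using w by (auto simp: worldsC)
  next
    fix a
    show "acc C a \<subseteq> worlds C \<times> worlds C"
      by (simp add: subset_iff worldsC accC)
  next
    fix a X assume "X \<in> worlds C"
    then obtain v where v: "v \<in> worlds K" "X = th v" unfolding worldsC by blast
    obtain u where "(v, u) \<in> acc K a" using ser[OF v(1)] by blast
    then show "\<exists>Y. (X, Y) \<in> acc C a" using step v(2) by blast
  next
    fix a
    show "trans (acc C a)"
    proof (rule transI)
      fix X Y Z assume XY: "(X, Y) \<in> acc C a" and YZ: "(Y, Z) \<in> acc C a"
      obtain v where v: "X = th v" using XY unfolding accC by blast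
      have "\<chi> \<in> Z" if "Box a \<chi> \<in> X" for \<chi>
        using four[of a \<chi> v] that v XY YZ unfolding accC by blast
      then show "(X, Z) \<in> acc C a" using XY YZ unfolding accC by blast
    qed
  next
    fix a
    have "(Y, Z) \<in> acc C a" if XY: "(X, Y) \<in> acc C a" and XZ: "(X, Z) \<in> acc C a" for X Y Z
    proof -
      obtain v u where v: "X = th v" and u: "Y = th u" using XY unfolding accC by blast
      have "\<chi> \<in> Z" if "Box a \<chi> \<in> Y" for \<chi>
      proof (cases "Box a \<chi> \<in> X")
        case True
        then show ?thesis using XZ unfolding accC by blast
      next
        case False
        then have "Neg (Box a \<chi>) \<in> Y" using five[of a \<chi> v] v XY unfolding accC by blast
        then show ?thesis using that unfolding u in_th by auto
      qed
      then show ?thesis using XY XZ unfolding accC by blast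
    qed
    then show "euclidean (acc C a)" unfolding euclidean_def by blast
  qed
  have truth: "holds C (th v) \<chi> \<longleftrightarrow> holds K v \<chi>" if "v \<in> worlds K" for v \<chi>
    using that
  proof (induction \<chi> arbitrary: v)
    case (Atom p)
    then show ?case by (simp add: C_def in_th)
  next
    case (Box a \<chi>)
    show ?case
    proof
      assume "holds C (th v) (Box a \<chi>)"
      then have "holds K u \<chi>" if "(v, u) \<in> acc K a" for u
        using Box.IH[of u] step[OF that] sub[of a] that by auto
      then show "holds K v (Box a \<chi>)" by simp
    next
      assume h: "holds K v (Box a \<chi>)"
      show "holds C (th v) (Box a \<chi>)"
        unfolding holds.simps
      proof (intro allI impI)
        fix X assume X: "(th v, X) \<in> acc C a"
        have "\<chi> \<in> X" using X h unfolding accC in_th by blast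
        moreover obtain u where "u \<in> worlds K" "X = th u" using X unfolding accC by blast
        ultimately show "holds C X \<chi>" using Box.IH by (simp add: in_th)
      qed
    qed
  qed auto
  have "th w \<in> worlds C" using w by (simp add: worldsC)
  then have "holds C (th w) \<phi> \<longleftrightarrow> holds C (th w) \<psi>"
    using eq kd by (auto simp: kd45_equiv_def)
  then show ?thesis using truth[OF w] by simp
qed


section \<open>Action models\<close>

record ('e, 'a, 'p) act_model =
  events :: "'e set"
  rel :: "'a \<Rightarrow> ('e \<times> 'e) set"
  pre :: "'e \<Rightarrow> ('a, 'p) fm"

type_synonym ('e, 'a, 'p) pointed = "('e, 'a, 'p) act_model \<times> 'e"

definition action_model :: "('e, 'a, 'p) act_model \<Rightarrow> bool" where
  "action_model N \<longleftrightarrow> events N \<noteq> {} \<and> (\<forall>a. rel N a \<subseteq> events N \<times> events N)"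

definition K45 :: "('e, 'a, 'p) act_model \<Rightarrow> bool" where
  "K45 N \<longleftrightarrow> (\<forall>a. trans (rel N a) \<and> euclidean (rel N a))"

definition FAct :: "('a, 'p) fm set \<Rightarrow> ('e, 'a, 'p) pointed set" where
  "FAct \<Phi> = {(N, t). action_model N \<and> finite (events N) \<and> K45 N \<and>
                     pre N ` events N \<subseteq> \<Phi> \<and> t \<in> events N}"

definition bisimulation ::
  "('e, 'a, 'p) act_model \<Rightarrow> ('f, 'a, 'p) act_model \<Rightarrow> ('e \<times> 'f) set \<Rightarrow> bool" where
  "bisimulation N N' Z \<longleftrightarrow> Z \<subseteq> events N \<times> events N' \<and>
     (\<forall>(s, s') \<in> Z.
        kd45_equiv (pre N s) (pre N' s') \<and>
        (\<forall>a. (\<forall>t. (s, t) \<in> rel N a \<longrightarrow> (\<exists>t'. (s', t') \<in> rel N' a \<and> (t, t') \<in> Z)) \<and>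
             (\<forall>t'. (s', t') \<in> rel N' a \<longrightarrow> (\<exists>t. (s, t) \<in> rel N a \<and> (t, t') \<in> Z))))"

definition bisimilar :: "('e, 'a, 'p) pointed \<Rightarrow> ('f, 'a, 'p) pointed \<Rightarrow> bool"
  (infix \<open>\<simeq>\<close> 50) where
  "M \<simeq> M' \<longleftrightarrow> (\<exists>Z. bisimulation (fst M) (fst M') Z \<and> (snd M, snd M') \<in> Z)"

definition agent_bisimilar ::
  "'a \<Rightarrow> ('e, 'a, 'p) pointed \<Rightarrow> ('f, 'a, 'p) pointed \<Rightarrow> bool" where
  "agent_bisimilar a M M' \<longleftrightarrow> (case (M, M') of ((N, s), (N', s')) \<Rightarrow>
     (\<forall>t. (s, t) \<in> rel N a \<longrightarrow> (\<exists>t'. (s', t') \<in> rel N' a \<and> (N, t) \<simeq> (N', t'))) \<and>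
     (\<forall>t'. (s', t') \<in> rel N' a \<longrightarrow> (\<exists>t. (s, t) \<in> rel N a \<and> (N, t) \<simeq> (N', t'))))"

definition gr :: "('e, 'a, 'p) pointed \<Rightarrow> 'a set" where
  "gr M = {a. \<exists>t. (snd M, t) \<in> rel (fst M) a}"


section \<open>Basic learning programs\<close>

text \<open>\<open>Learn B \<alpha> \<alpha>s\<close> is \<open>L\<^sub>B(\<alpha>, \<alpha>s)\<close>, with the first argument separate because there is at least
  one; \<open>Cap \<alpha> \<beta>\<close> is \<open>\<alpha> \<inter> \<beta>\<close>; \<open>Restr \<psi> B \<alpha>\<close> is \<open>\<psi>|\<^sub>B\<alpha>\<close>. The datatype consists of raw
  programs; the side conditions are imposed by the inductive set \<open>BLP\<close>.\<close>

datatype ('a, 'p) prog =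
    Test "('a, 'p) fm"
  | Learn "'a set" "('a, 'p) prog" "('a, 'p) prog list"
  | Cap "('a, 'p) prog" "('a, 'p) prog"
  | Restr "('a, 'p) fm" "'a set" "('a, 'p) prog"

primrec prog_group :: "('a, 'p) prog \<Rightarrow> 'a set" where
  "prog_group (Test \<phi>) = {}"
| "prog_group (Learn B \<alpha> \<alpha>s) = B \<union> prog_group \<alpha>"
| "prog_group (Cap \<alpha> \<beta>) = prog_group \<alpha> \<union> prog_group \<beta>"
| "prog_group (Restr \<psi> B \<alpha>) = B"

primrec prog_pre :: "('a, 'p) prog \<Rightarrow> ('a, 'p) fm" where
  "prog_pre (Test \<phi>) = \<phi>"
| "prog_pre (Learn B \<alpha> \<alpha>s) = prog_pre \<alpha>"
| "prog_pre (Cap \<alpha> \<beta>) = prog_pre \<alpha>"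
| "prog_pre (Restr \<psi> B \<alpha>) = \<psi>"

inductive_set BLP :: "('a, 'p) fm set \<Rightarrow> ('a, 'p) prog set" for \<Phi> where
  "\<phi> \<in> \<Phi> \<Longrightarrow> Test \<phi> \<in> BLP \<Phi>"
| "\<alpha> \<in> BLP \<Phi> \<Longrightarrow> (\<And>\<beta>. \<beta> \<in> set \<alpha>s \<Longrightarrow> \<beta> \<in> BLP \<Phi>) \<Longrightarrow> Learn B \<alpha> \<alpha>s \<in> BLP \<Phi>"
| "\<alpha> \<in> BLP \<Phi> \<Longrightarrow> \<beta> \<in> BLP \<Phi> \<Longrightarrow> prog_pre \<alpha> = prog_pre \<beta> \<Longrightarrow>
     prog_group \<alpha> \<inter> prog_group \<beta> = {} \<Longrightarrow> Cap \<alpha> \<beta> \<in> BLP \<Phi>"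
| "\<alpha> \<in> BLP \<Phi> \<Longrightarrow> B \<subseteq> prog_group \<alpha> \<Longrightarrow> Restr \<psi> B \<alpha> \<in> BLP \<Phi>"

text \<open>Events of the models denoted by programs. \<open>Old l e\<close> is the copy of event \<open>e\<close> of the \<open>l\<close>-th
  component model (counting from 0), so that components are always disjoint; \<open>New l\<close> is a fresh
  event, namely \<open>(s\<^sub>l, 1)\<close> in a learning program and the added actual event (with \<open>l = 0\<close>)
  otherwise.\<close>

datatype ev = New nat | Old nat ev

definition test_sem :: "('a, 'p) fm \<Rightarrow> (ev, 'a, 'p) pointed" where
  "test_sem \<phi> = (\<lparr>events = {New 0}, rel = (\<lambda>a. {}), pre = (\<lambda>e. \<phi>)\<rparr>, New 0)"

definition old_events :: "(ev, 'a, 'p) pointed list \<Rightarrow> ev set" where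
  "old_events Ms = {Old l e | l e. l < length Ms \<and> e \<in> events (fst (Ms ! l))}"

definition old_rel :: "(ev, 'a, 'p) pointed list \<Rightarrow> 'a \<Rightarrow> (ev \<times> ev) set" where
  "old_rel Ms a = {(Old l e, Old l e') | l e e'. l < length Ms \<and> (e, e') \<in> rel (fst (Ms ! l)) a}"

definition learn_sem :: "'a set \<Rightarrow> (ev, 'a, 'p) pointed list \<Rightarrow> (ev, 'a, 'p) pointed" where
  "learn_sem B Ms =
     (\<lparr>events = {New l | l. l < length Ms} \<union> old_events Ms,
       rel = (\<lambda>a. {(New i, New j) | i j. i < length Ms \<and> j < length Ms \<and> a \<in> B \<and>
                      agent_bisimilar a (Ms ! i) (Ms ! j)} \<union>
                  {(New j, Old j t) | j t. j < length Ms \<and> a \<in> gr (Ms ! j) - B \<and>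
                      (snd (Ms ! j), t) \<in> rel (fst (Ms ! j)) a} \<union>
                  old_rel Ms a),
       pre = (\<lambda>e. case e of New l \<Rightarrow> pre (fst (Ms ! l)) (snd (Ms ! l))
                          | Old l e' \<Rightarrow> pre (fst (Ms ! l)) e')\<rparr>,
      New 0)"

text \<open>\<open>cap_sem\<close> keeps the whole disjoint union; the groups \<open>B\<close> and \<open>C\<close> of the two programs only
  govern the arrows leaving the new actual event.\<close>

definition cap_sem ::
  "'a set \<Rightarrow> (ev, 'a, 'p) pointed \<Rightarrow> 'a set \<Rightarrow> (ev, 'a, 'p) pointed \<Rightarrow> (ev, 'a, 'p) pointed" where
  "cap_sem B M C M' =
     (\<lparr>events = insert (New 0) (old_events [M, M']),
       rel = (\<lambda>a. old_rel [M, M'] a \<union>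
                  {(New 0, Old 0 t) | t. a \<in> B \<and> (snd M, t) \<in> rel (fst M) a} \<union>
                  {(New 0, Old 1 t) | t. a \<in> C \<and> (snd M', t) \<in> rel (fst M') a}),
       pre = (\<lambda>e. case e of New _ \<Rightarrow> pre (fst M) (snd M)
                          | Old l e' \<Rightarrow> pre (fst ([M, M'] ! l)) e')\<rparr>,
      New 0)"

definition restr_sem ::
  "('a, 'p) fm \<Rightarrow> 'a set \<Rightarrow> (ev, 'a, 'p) pointed \<Rightarrow> (ev, 'a, 'p) pointed" where
  "restr_sem \<psi> B M =
     (\<lparr>events = insert (New 0) (old_events [M]),
       rel = (\<lambda>a. old_rel [M] a \<union>
                  {(New 0, Old 0 t) | t. a \<in> B \<and> (snd M, t) \<in> rel (fst M) a}),
       pre = (\<lambda>e. case e of New _ \<Rightarrow> \<psi> | Old _ e' \<Rightarrow> pre (fst M) e')\<rparr>,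
      New 0)"

primrec sem :: "('a, 'p) prog \<Rightarrow> (ev, 'a, 'p) pointed" where
  "sem (Test \<phi>) = test_sem \<phi>"
| "sem (Learn B \<alpha> \<alpha>s) = learn_sem B (sem \<alpha> # map sem \<alpha>s)"
| "sem (Cap \<alpha> \<beta>) = cap_sem (prog_group \<alpha>) (sem \<alpha>) (prog_group \<beta>) (sem \<beta>)"
| "sem (Restr \<psi> B \<alpha>) = restr_sem \<psi> B (sem \<alpha>)"

definition basic_learning_action :: "('a, 'p) fm set \<Rightarrow> ('e, 'a, 'p) pointed \<Rightarrow> bool" where
  "basic_learning_action \<Phi> M \<longleftrightarrow> M \<in> FAct \<Phi> \<and> (\<exists>\<alpha> \<in> BLP \<Phi>. M \<simeq> sem \<alpha>)"


section \<open>The graph of maximal S5 submodels\<close>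

text \<open>A submodel of \<open>N\<close> is determined by its set of events \<open>S\<close> and its set of agents \<open>B\<close>, and is
  represented by the pair \<open>(S, B)\<close>; its relations and preconditions are those of \<open>N\<close> restricted to
  \<open>S\<close>. Like every model, it has at least one event.\<close>

type_synonym ('e, 'a) sub = "'e set \<times> 'a set"

definition sub_rel :: "('e, 'a, 'p) act_model \<Rightarrow> ('e, 'a) sub \<Rightarrow> 'a \<Rightarrow> ('e \<times> 'e) set" where
  "sub_rel N M a = (if a \<in> snd M then rel N a \<inter> (fst M \<times> fst M) else {})"

definition S5_sub :: "('e, 'a, 'p) act_model \<Rightarrow> ('e, 'a) sub \<Rightarrow> bool" where
  "S5_sub N M \<longleftrightarrow> fst M \<noteq> {} \<and> fst M \<subseteq> events N \<and>
     (\<forall>a \<in> snd M. refl_on (fst M) (sub_rel N M a) \<and>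
                  trans (sub_rel N M a) \<and> euclidean (sub_rel N M a))"

definition connected_sub :: "('e, 'a, 'p) act_model \<Rightarrow> ('e, 'a) sub \<Rightarrow> bool" where
  "connected_sub N M \<longleftrightarrow>
     (\<forall>s \<in> fst M. \<forall>t \<in> fst M. s \<noteq> t \<longrightarrow> (s, t) \<in> (\<Union>a \<in> snd M. sub_rel N M a)\<^sup>+)"

definition closed_sub :: "('e, 'a, 'p) act_model \<Rightarrow> ('e, 'a) sub \<Rightarrow> bool" where
  "closed_sub N M \<longleftrightarrow>
     (\<forall>s \<in> fst M. \<forall>a \<in> snd M. \<forall>t. (s, t) \<in> rel N a \<longrightarrow> t \<in> fst M)"

definition ccS5 :: "('e, 'a, 'p) act_model \<Rightarrow> ('e, 'a) sub set" where
  "ccS5 N = {M. S5_sub N M \<and> connected_sub N M \<and> closed_sub N M}"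

definition sub_le :: "('e, 'a) sub \<Rightarrow> ('e, 'a) sub \<Rightarrow> bool" where
  "sub_le M M' \<longleftrightarrow> fst M \<subseteq> fst M' \<and> snd M \<subseteq> snd M'"

definition max_ccS5 :: "('e, 'a, 'p) act_model \<Rightarrow> ('e, 'a) sub set" where
  "max_ccS5 N = {M \<in> ccS5 N. \<forall>M' \<in> ccS5 N. sub_le M M' \<longrightarrow> M' = M}"

text \<open>The maximal submodels themselves serve as the indices \<open>i\<close>.\<close>

definition T_model :: "('e, 'a, 'p) act_model \<Rightarrow> ('e \<times> ('e, 'a) sub, 'a, 'p) act_model" where
  "T_model N = \<lparr>events = {(s, M). M \<in> max_ccS5 N \<and> s \<in> fst M},
          rel = (\<lambda>a. {((s, M), (t, M')). M \<in> max_ccS5 N \<and> M' \<in> max_ccS5 N \<and>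
                        s \<in> fst M \<and> t \<in> fst M' \<and>
                        (M = M' \<and> (s, t) \<in> sub_rel N M a \<or>
                         M \<noteq> M' \<and> a \<notin> snd M \<and> a \<in> snd M' \<and> (s, t) \<in> rel N a)}),
          pre = (\<lambda>(s, M). pre N s)\<rparr>"

definition G_nodes :: "('e, 'a, 'p) act_model \<Rightarrow> ('e, 'a) sub set" where
  "G_nodes N = max_ccS5 N"

definition G_edges :: "('e, 'a, 'p) act_model \<Rightarrow> (('e, 'a) sub \<times> ('e, 'a) sub) set" where
  "G_edges N = {(M, M'). M \<in> max_ccS5 N \<and> M' \<in> max_ccS5 N \<and> M \<noteq> M' \<and>
                  (\<exists>s t a. ((s, M), (t, M')) \<in> rel (T_model N) a)}"

text \<open>A directed graph is a tree if its underlying undirected graph is: any two nodes are joined by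
  exactly one undirected simple path. A pair of opposite edges is a cycle of length two and is
  therefore excluded. (\<open>tree\<close> in \<open>Graph_Theory\<close> only forbids directed cycles.) Rooted trees, with
  edges pointing away from the root, are a special case.\<close>

definition simple_path :: "'n set \<Rightarrow> ('n \<times> 'n) set \<Rightarrow> 'n \<Rightarrow> 'n list \<Rightarrow> 'n \<Rightarrow> bool" where
  "simple_path V E u p v \<longleftrightarrow> p \<noteq> [] \<and> hd p = u \<and> last p = v \<and> set p \<subseteq> V \<and> distinct p \<and>
     successively (\<lambda>x y. (x, y) \<in> E \<union> E\<inverse>) p"

definition finite_tree :: "'n set \<Rightarrow> ('n \<times> 'n) set \<Rightarrow> bool" where
  "finite_tree V E \<longleftrightarrow> finite V \<and> V \<noteq> {} \<and> E \<subseteq> V \<times> V \<and>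
     (\<forall>u v. (u, v) \<in> E \<longrightarrow> (v, u) \<notin> E) \<and>
     (\<forall>u \<in> V. \<forall>v \<in> V. \<exists>!p. simple_path V E u p v)"

end

(* In a tree no two edges are opposite. Two maximal submodels sharing an event would be joined by
   opposite edges, so every event lies in exactly one node (S, B), B is the set of agents with a loop
   there, and every other arrow leads to another node along an edge. A tree has no directed cycle
   either, so a program for each event can be built by induction along the edges.

   At a node (S, B) the program is L_B applied to programs alpha_s for the s in S. The arrows of
   alpha_s for agents outside B are obtained from programs for their targets, using restriction and
   intersection. Its arrows for agents in B only serve to make the relations of L_B right: they lead
   to auxiliary labels, bisimilar exactly when they stand for the same cluster. Since restriction
   admits arbitrary formulas but there may be only finitely many up to equivalence, the labels are
   told apart by their relational structure, as chains alternating between two agents of B; with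
   fewer than two agents in B there is a single cluster per agent and no label is needed. *)

theory Submission
  imports Defs
begin

section \<open>Bisimilarity\<close>

lemma kd45_equiv_refl [simp]: "kd45_equiv \<phi> \<phi>"
  by (simp add: kd45_equiv_def)

lemma kd45_equiv_sym: "kd45_equiv \<phi> \<psi> \<Longrightarrow> kd45_equiv \<psi> \<phi>"
  unfolding kd45_equiv_def by blast

lemma kd45_equiv_trans: "kd45_equiv \<phi> \<psi> \<Longrightarrow> kd45_equiv \<psi> \<chi> \<Longrightarrow> kd45_equiv \<phi> \<chi>"
  unfolding kd45_equiv_def by blast

lemma agent_bisimilar_iff:
  "agent_bisimilar a M M' \<longleftrightarrow>
     (\<forall>t. (snd M, t) \<in> rel (fst M) a \<longrightarrow>
        (\<exists>t'. (snd M', t') \<in> rel (fst M') a \<and> (fst M, t) \<simeq> (fst M', t'))) \<and>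
     (\<forall>t'. (snd M', t') \<in> rel (fst M') a \<longrightarrow>
        (\<exists>t. (snd M, t) \<in> rel (fst M) a \<and> (fst M, t) \<simeq> (fst M', t')))"
  by (cases M; cases M') (simp add: agent_bisimilar_def)

lemma bisimilar_sym:
  assumes "M \<simeq> M'"
  shows "M' \<simeq> M"
proof -
  obtain Z where Z: "bisimulation (fst M) (fst M') Z" "(snd M, snd M') \<in> Z"
    using assms unfolding bisimilar_def by blast
  have "bisimulation (fst M') (fst M) (Z\<inverse>)"
    using Z(1) unfolding bisimulation_def by (auto intro: kd45_equiv_sym; blast)
  then show ?thesis using Z(2) unfolding bisimilar_def by blast
qed

lemma bisimilar_trans:
  assumes "M \<simeq> M'" "M' \<simeq> M''"
  shows "M \<simeq> M''"
proof -
  obtain Z where Z: "bisimulation (fst M) (fst M') Z" "(snd M, snd M') \<in> Z"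
    using assms unfolding bisimilar_def by blast
  obtain Y where Y: "bisimulation (fst M') (fst M'') Y" "(snd M', snd M'') \<in> Y"
    using assms unfolding bisimilar_def by blast
  have "bisimulation (fst M) (fst M'') (Z O Y)"
    unfolding bisimulation_def
  proof (intro conjI ballI)
    show "Z O Y \<subseteq> events (fst M) \<times> events (fst M'')"
      using Z(1) Y(1) unfolding bisimulation_def by blast
  next
    fix p assume "p \<in> Z O Y"
    then obtain x y z where p: "p = (x, z)" and xy: "(x, y) \<in> Z" and yz: "(y, z) \<in> Y" by blast
    have 1: "kd45_equiv (pre (fst M) x) (pre (fst M') y)"
      "\<And>a t. (x, t) \<in> rel (fst M) a \<Longrightarrow> \<exists>t'. (y, t') \<in> rel (fst M') a \<and> (t, t') \<in> Z"
      "\<And>a t'. (y, t') \<in> rel (fst M') a \<Longrightarrow> \<exists>t. (x, t) \<in> rel (fst M) a \<and> (t, t') \<in> Z"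
      using Z(1) xy unfolding bisimulation_def by blast+
    have 2: "kd45_equiv (pre (fst M') y) (pre (fst M'') z)"
      "\<And>a t. (y, t) \<in> rel (fst M') a \<Longrightarrow> \<exists>t'. (z, t') \<in> rel (fst M'') a \<and> (t, t') \<in> Y"
      "\<And>a t'. (z, t') \<in> rel (fst M'') a \<Longrightarrow> \<exists>t. (y, t) \<in> rel (fst M') a \<and> (t, t') \<in> Y"
      using Y(1) yz unfolding bisimulation_def by blast+
    show "case p of (s, s') \<Rightarrow> kd45_equiv (pre (fst M) s) (pre (fst M'') s') \<and>
        (\<forall>a. (\<forall>t. (s, t) \<in> rel (fst M) a \<longrightarrow> (\<exists>t'. (s', t') \<in> rel (fst M'') a \<and> (t, t') \<in> Z O Y)) \<and>
             (\<forall>t'. (s', t') \<in> rel (fst M'') a \<longrightarrow> (\<exists>t. (s, t) \<in> rel (fst M) a \<and> (t, t') \<in> Z O Y)))"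
      unfolding p split using kd45_equiv_trans[OF 1(1) 2(1)]
      by (meson 1(2,3) 2(2,3) relcomp.relcompI)
  qed
  then show ?thesis using Z(2) Y(2) unfolding bisimilar_def by auto
qed

lemma bisimilar_agent:
  assumes "M \<simeq> M'"
  shows "agent_bisimilar a M M'"
proof -
  obtain Z where Z: "bisimulation (fst M) (fst M') Z" "(snd M, snd M') \<in> Z"
    using assms unfolding bisimilar_def by blast
  then have "(\<forall>t. (snd M, t) \<in> rel (fst M) a \<longrightarrow> (\<exists>t'. (snd M', t') \<in> rel (fst M') a \<and> (t, t') \<in> Z)) \<and>
      (\<forall>t'. (snd M', t') \<in> rel (fst M') a \<longrightarrow> (\<exists>t. (snd M, t) \<in> rel (fst M) a \<and> (t, t') \<in> Z))"
    unfolding bisimulation_def by blast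
  moreover have "(fst M, t) \<simeq> (fst M', t')" if "(t, t') \<in> Z" for t t'
    using that Z unfolding bisimilar_def by auto
  ultimately show ?thesis unfolding agent_bisimilar_iff by blast
qed

lemma bisimilar_pre:
  "M \<simeq> M' \<Longrightarrow> kd45_equiv (pre (fst M) (snd M)) (pre (fst M') (snd M'))"
  unfolding bisimilar_def bisimulation_def by blast

lemma bisimilar_events:
  "M \<simeq> M' \<Longrightarrow> snd M \<in> events (fst M) \<and> snd M' \<in> events (fst M')"
  unfolding bisimilar_def bisimulation_def by blast

text \<open>Bisimulation up to bisimilarity: the union of \<open>Z\<close> with bisimilarity itself
  is a bisimulation. Thus \<open>Z\<close> need list only the freshly added events of a compound
  model; matches among copied events are bisimilar already.\<close>

lemma bisimilar_coinduct:
  assumes "(s, s') \<in> Z" and sub: "Z \<subseteq> events N \<times> events N'"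
    and pr: "\<And>s s'. (s, s') \<in> Z \<Longrightarrow> kd45_equiv (pre N s) (pre N' s')"
    and zig: "\<And>s s' a t. (s, s') \<in> Z \<Longrightarrow> (s, t) \<in> rel N a \<Longrightarrow>
      \<exists>t'. (s', t') \<in> rel N' a \<and> ((t, t') \<in> Z \<or> (N, t) \<simeq> (N', t'))"
    and zag: "\<And>s s' a t'. (s, s') \<in> Z \<Longrightarrow> (s', t') \<in> rel N' a \<Longrightarrow>
      \<exists>t. (s, t) \<in> rel N a \<and> ((t, t') \<in> Z \<or> (N, t) \<simeq> (N', t'))"
  shows "(N, s) \<simeq> (N', s')"
proof -
  define W where "W = Z \<union> {(s, s'). (N, s) \<simeq> (N', s')}"
  have "bisimulation N N' W"
    unfolding bisimulation_def
  proof (intro conjI ballI)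
    show "W \<subseteq> events N \<times> events N'"
      using sub bisimilar_events unfolding W_def by fastforce
  next
    fix p assume p: "p \<in> W"
    obtain x y where xy: "p = (x, y)" by (cases p)
    have "kd45_equiv (pre N x) (pre N' y) \<and>
        (\<forall>a. (\<forall>t. (x, t) \<in> rel N a \<longrightarrow> (\<exists>t'. (y, t') \<in> rel N' a \<and> (t, t') \<in> W)) \<and>
             (\<forall>t'. (y, t') \<in> rel N' a \<longrightarrow> (\<exists>t. (x, t) \<in> rel N a \<and> (t, t') \<in> W)))"
    proof (cases "(x, y) \<in> Z")
      case True
      then show ?thesis using pr zig zag unfolding W_def by fastforce
    next
      case False
      then have b: "(N, x) \<simeq> (N', y)" using p xy by (simp add: W_def)
      show ?thesis
        using bisimilar_pre[OF b] bisimilar_agent[OF b]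
        unfolding agent_bisimilar_iff W_def by fastforce
    qed
    then show "case p of (s, s') \<Rightarrow> kd45_equiv (pre N s) (pre N' s') \<and>
        (\<forall>a. (\<forall>t. (s, t) \<in> rel N a \<longrightarrow> (\<exists>t'. (s', t') \<in> rel N' a \<and> (t, t') \<in> W)) \<and>
             (\<forall>t'. (s', t') \<in> rel N' a \<longrightarrow> (\<exists>t. (s, t) \<in> rel N a \<and> (t, t') \<in> W)))"
      by (simp add: xy)
  qed
  then show ?thesis using assms(1) unfolding bisimilar_def W_def by auto
qed

text \<open>The graph of \<open>f\<close> is a bisimulation: no arrow leaves the image of
  \<open>f\<close>, and every arrow starting there comes from an arrow of \<open>N\<close>.\<close>

lemma bisimilar_embedding:
  assumes am: "action_model N" and e: "e \<in> events N"
    and ev: "\<And>e. e \<in> events N \<Longrightarrow> f e \<in> events N'"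
    and pr: "\<And>e. e \<in> events N \<Longrightarrow> pre N' (f e) = pre N e"
    and re: "\<And>e a. e \<in> events N \<Longrightarrow> rel N' a `` {f e} = f ` (rel N a `` {e})"
  shows "(N, e) \<simeq> (N', f e)"
proof (rule bisimilar_coinduct[where Z = "{(e, f e) | e. e \<in> events N}"])
  fix s s' a t assume s: "(s, s') \<in> {(e, f e) | e. e \<in> events N}" and t: "(s, t) \<in> rel N a"
  have "f t \<in> rel N' a `` {f s}" using re[of s a] s t by auto
  moreover have "t \<in> events N" using am t unfolding action_model_def by blast
  ultimately show "\<exists>t'. (s', t') \<in> rel N' a \<and>
      ((t, t') \<in> {(e, f e) | e. e \<in> events N} \<or> (N, t) \<simeq> (N', t'))"
    using s by blast
next
  fix s s' a t' assume s: "(s, s') \<in> {(e, f e) | e. e \<in> events N}" and t: "(s', t') \<in> rel N' a"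
  have "t' \<in> f ` (rel N a `` {s})" using re[of s a] s t by auto
  then obtain t where "(s, t) \<in> rel N a" "t' = f t" by blast
  moreover have "t \<in> events N" using am \<open>(s, t) \<in> rel N a\<close> unfolding action_model_def by blast
  ultimately show "\<exists>t. (s, t) \<in> rel N a \<and>
      ((t, t') \<in> {(e, f e) | e. e \<in> events N} \<or> (N, t) \<simeq> (N', t'))"
    by blast
qed (use e ev pr in auto)

lemma bisimilar_refl:
  "action_model N \<Longrightarrow> e \<in> events N \<Longrightarrow> (N, e) \<simeq> (N, e)"
  using bisimilar_embedding[of N e "\<lambda>x. x" N] by auto

lemma agent_bisimilar_sym: "agent_bisimilar a M M' \<Longrightarrow> agent_bisimilar a M' M"
  unfolding agent_bisimilar_iff using bisimilar_sym by blast

lemma agent_bisimilar_trans: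
  assumes "agent_bisimilar a M M'" "agent_bisimilar a M' M''"
  shows "agent_bisimilar a M M''"
  using assms unfolding agent_bisimilar_iff by (meson bisimilar_trans)

text \<open>Each common successor is matched with itself. In a K45 model this applies to an event
  and any of its \<open>a\<close>-successors.\<close>

lemma agent_bisimilar_same_successors:
  assumes "action_model N" "rel N a `` {s} = rel N a `` {t}"
  shows "agent_bisimilar a (N, s) (N, t)"
proof -
  have "(N, u) \<simeq> (N, u)" if "(s, u) \<in> rel N a \<or> (t, u) \<in> rel N a" for u
    by (rule bisimilar_refl) (use assms(1) that in \<open>auto simp: action_model_def\<close>)
  moreover have "(s, u) \<in> rel N a \<longleftrightarrow> (t, u) \<in> rel N a" for u using assms(2) by blast
  ultimately show ?thesis unfolding agent_bisimilar_iff by auto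
qed


section \<open>Semantics of programs\<close>

text \<open>Bisimulations relate events only, so even reflexivity of \<open>\<simeq>\<close> depends
  on the point and all arrows staying inside \<open>events\<close>.\<close>

definition wf_pointed :: "('e, 'a, 'p) pointed \<Rightarrow> bool" where
  "wf_pointed M \<longleftrightarrow> action_model (fst M) \<and> snd M \<in> events (fst M)"

lemma wf_pointed_bisimilar_refl: "wf_pointed M \<Longrightarrow> M \<simeq> M"
  using bisimilar_refl[of "fst M" "snd M"] by (simp add: wf_pointed_def)

lemma wf_pointed_rel:
  "wf_pointed M \<Longrightarrow> (e, e') \<in> rel (fst M) a \<Longrightarrow> e \<in> events (fst M) \<and> e' \<in> events (fst M)"
  unfolding wf_pointed_def action_model_def by blast

lemma wf_learn_sem:
  assumes "\<And>M. M \<in> set Ms \<Longrightarrow> wf_pointed M" "Ms \<noteq> []"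
  shows "wf_pointed (learn_sem B Ms)"
proof -
  have "e \<in> events (fst (Ms ! l)) \<and> e' \<in> events (fst (Ms ! l))"
    if "l < length Ms" "(e, e') \<in> rel (fst (Ms ! l)) a" for l e e' a
    using wf_pointed_rel[OF assms(1)[OF nth_mem]] that by blast
  then show ?thesis using assms(2)
    unfolding wf_pointed_def action_model_def
    by (auto simp: learn_sem_def old_events_def old_rel_def)
qed

lemma wf_cap_sem:
  assumes "wf_pointed M" "wf_pointed M'"
  shows "wf_pointed (cap_sem B M C M')"
  using wf_pointed_rel[OF assms(1)] wf_pointed_rel[OF assms(2)]
  unfolding wf_pointed_def action_model_def
  by (auto simp: cap_sem_def old_events_def old_rel_def less_Suc_eq)

lemma wf_restr_sem:
  assumes "wf_pointed M"
  shows "wf_pointed (restr_sem \<psi> B M)"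
  using wf_pointed_rel[OF assms(1)]
  unfolding wf_pointed_def action_model_def
  by (auto simp: restr_sem_def old_events_def old_rel_def)

lemma wf_sem: "wf_pointed (sem \<alpha>)"
proof (induction \<alpha>)
  case (Test \<phi>)
  then show ?case by (simp add: wf_pointed_def action_model_def test_sem_def)
next
  case (Learn B \<alpha> \<alpha>s)
  then show ?case by (auto intro!: wf_learn_sem)
qed (auto intro: wf_cap_sem wf_restr_sem)

lemma sem_bisimilar_refl [simp]: "sem \<alpha> \<simeq> sem \<alpha>"
  by (rule wf_pointed_bisimilar_refl[OF wf_sem])

lemma pre_sem: "pre (fst (sem \<alpha>)) (snd (sem \<alpha>)) = prog_pre \<alpha>"
  by (induction \<alpha>) (auto simp: test_sem_def learn_sem_def cap_sem_def restr_sem_def)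

section \<open>Component models inside the models of compound programs\<close>

lemma learn_sem_embedding:
  assumes "\<And>M. M \<in> set Ms \<Longrightarrow> wf_pointed M" "l < length Ms" "e \<in> events (fst (Ms ! l))"
  shows "(fst (Ms ! l), e) \<simeq> (fst (learn_sem B Ms), Old l e)"
  by (rule bisimilar_embedding)
    (use assms in \<open>auto simp: learn_sem_def old_events_def old_rel_def wf_pointed_def\<close>)

lemma cap_sem_embedding:
  assumes "wf_pointed M" "wf_pointed M'"
  shows "e \<in> events (fst M) \<Longrightarrow> (fst M, e) \<simeq> (fst (cap_sem B M C M'), Old 0 e)"
    and "e \<in> events (fst M') \<Longrightarrow> (fst M', e) \<simeq> (fst (cap_sem B M C M'), Old 1 e)"
  by (rule bisimilar_embedding;
      use assms in \<open>force simp: cap_sem_def old_events_def old_rel_def wf_pointed_def less_Suc_eq\<close>)+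

lemma restr_sem_embedding:
  assumes "wf_pointed M" "e \<in> events (fst M)"
  shows "(fst M, e) \<simeq> (fst (restr_sem \<psi> B M), Old 0 e)"
  by (rule bisimilar_embedding)
    (use assms in \<open>auto simp: restr_sem_def old_events_def old_rel_def wf_pointed_def\<close>)

lemma agent_bisimilar_embedding:
  assumes "rel N' a `` {s'} = f ` (rel N a `` {s})"
    and "\<And>t. (s, t) \<in> rel N a \<Longrightarrow> (N, t) \<simeq> (N', f t)"
  shows "agent_bisimilar a (N', s') (N, s)"
  unfolding agent_bisimilar_iff fst_conv snd_conv
proof (intro conjI allI impI)
  fix t' assume "(s', t') \<in> rel N' a"
  then have "t' \<in> f ` (rel N a `` {s})" using assms(1) by blast
  then obtain t where "(s, t) \<in> rel N a" "t' = f t" by blast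
  then show "\<exists>t. (s, t) \<in> rel N a \<and> (N', t') \<simeq> (N, t)"
    using bisimilar_sym[OF assms(2)] by blast
next
  fix t assume t: "(s, t) \<in> rel N a"
  then have "f t \<in> rel N' a `` {s'}" using assms(1) by blast
  then show "\<exists>t'. (s', t') \<in> rel N' a \<and> (N', t') \<simeq> (N, t)"
    using bisimilar_sym[OF assms(2)[OF t]] by blast
qed

text \<open>With \<open>a\<close> in \<open>B\<close> but not in \<open>C\<close>, the
  \<open>a\<close>-arrows of the new event are exactly the copies of those of the left
  component.\<close>

lemma cap_sem_agent_left:
  assumes "wf_pointed M" "wf_pointed M'" "a \<in> B" "a \<notin> C"
  shows "agent_bisimilar a (cap_sem B M C M') M"
proof -
  have "agent_bisimilar a (fst (cap_sem B M C M'), New 0) (fst M, snd M)"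
  proof (rule agent_bisimilar_embedding[where f = "Old 0"])
    show "rel (fst (cap_sem B M C M')) a `` {New 0} = Old 0 ` (rel (fst M) a `` {snd M})"
      using assms(3,4) by (auto simp: cap_sem_def old_rel_def)
  qed (use assms(1,2) in \<open>simp add: cap_sem_embedding(1) wf_pointed_rel\<close>)
  then show ?thesis by (simp add: cap_sem_def)
qed

lemma cap_sem_agent_right:
  assumes "wf_pointed M" "wf_pointed M'" "a \<notin> B" "a \<in> C"
  shows "agent_bisimilar a (cap_sem B M C M') M'"
proof -
  have "agent_bisimilar a (fst (cap_sem B M C M'), New 0) (fst M', snd M')"
  proof (rule agent_bisimilar_embedding[where f = "Old 1"])
    show "rel (fst (cap_sem B M C M')) a `` {New 0} = Old 1 ` (rel (fst M') a `` {snd M'})"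
      using assms(3,4) by (auto simp: cap_sem_def old_rel_def)
    fix t assume "(snd M', t) \<in> rel (fst M') a"
    then show "(fst M', t) \<simeq> (fst (cap_sem B M C M'), Old 1 t)"
      using cap_sem_embedding(2)[OF assms(1,2)] wf_pointed_rel[OF assms(2)] by blast
  qed
  then show ?thesis by (simp add: cap_sem_def)
qed

lemma restr_sem_agent:
  assumes "wf_pointed M" "a \<in> B"
  shows "agent_bisimilar a (restr_sem \<psi> B M) M"
proof -
  have "agent_bisimilar a (fst (restr_sem \<psi> B M), New 0) (fst M, snd M)"
  proof (rule agent_bisimilar_embedding[where f = "Old 0"])
    show "rel (fst (restr_sem \<psi> B M)) a `` {New 0} = Old 0 ` (rel (fst M) a `` {snd M})"
      using assms(2) by (auto simp: restr_sem_def old_rel_def)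
  qed (use assms(1) in \<open>simp add: restr_sem_embedding wf_pointed_rel\<close>)
  then show ?thesis by (simp add: restr_sem_def)
qed

lemma learn_sem_rel_New_in:
  "a \<in> B \<Longrightarrow> (New i, e) \<in> rel (fst (learn_sem B Ms)) a \<longleftrightarrow>
     (\<exists>j. e = New j \<and> i < length Ms \<and> j < length Ms \<and> agent_bisimilar a (Ms ! i) (Ms ! j))"
  by (auto simp: learn_sem_def old_rel_def)

lemma learn_sem_rel_New_notin:
  "a \<notin> B \<Longrightarrow> (New i, e) \<in> rel (fst (learn_sem B Ms)) a \<longleftrightarrow>
     (\<exists>t. e = Old i t \<and> i < length Ms \<and> (snd (Ms ! i), t) \<in> rel (fst (Ms ! i)) a)"
  by (auto simp: learn_sem_def old_rel_def gr_def)

lemma learn_sem_agent: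
  assumes wf: "\<And>M. M \<in> set Ms \<Longrightarrow> wf_pointed M" and i: "i < length Ms" and a: "a \<notin> B"
  shows "agent_bisimilar a (fst (learn_sem B Ms), New i) (Ms ! i)"
proof -
  have "agent_bisimilar a (fst (learn_sem B Ms), New i) (fst (Ms ! i), snd (Ms ! i))"
  proof (rule agent_bisimilar_embedding[where f = "Old i"])
    show "rel (fst (learn_sem B Ms)) a `` {New i} = Old i ` (rel (fst (Ms ! i)) a `` {snd (Ms ! i)})"
      using i by (auto simp: learn_sem_rel_New_notin[OF a])
  qed (use wf i in \<open>simp add: learn_sem_embedding wf_pointed_rel\<close>)
  then show ?thesis by simp
qed

lemma snd_learn_sem [simp]: "snd (learn_sem B Ms) = New 0"
  by (simp add: learn_sem_def)

text \<open>The map \<open>g\<close> prescribes, agent by agent, a program whose arrows are to be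
  imitated. Infinitely many agents may be involved, so the induction runs over a finite set of
  programs, and all agents with the same program are served at once.\<close>

lemma assemble:
  assumes "finite P" "ran g \<subseteq> P" "\<phi> \<in> \<Phi>"
    and "\<And>a \<beta>. g a = Some \<beta> \<Longrightarrow> \<beta> \<in> BLP \<Phi> \<and> a \<in> prog_group \<beta>"
  shows "\<exists>\<alpha> \<in> BLP \<Phi>. prog_pre \<alpha> = \<phi> \<and> prog_group \<alpha> = dom g \<and>
     (\<forall>a. case g a of None \<Rightarrow> a \<notin> gr (sem \<alpha>) | Some \<beta> \<Rightarrow> agent_bisimilar a (sem \<alpha>) (sem \<beta>))"
  using assms
proof (induction P arbitrary: g rule: finite_induct)
  case empty
  have "g a = None" for a
    using empty.prems(1) ranI[of g a] by (cases "g a") auto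
  then have "g = Map.empty" by blast
  moreover have "Test \<phi> \<in> BLP \<Phi>" using empty.prems by (intro BLP.intros)
  ultimately show ?case by (intro bexI[of _ "Test \<phi>"]) (auto simp: gr_def test_sem_def)
next
  case (insert \<beta> P)
  define D where "D = {a. g a = Some \<beta>}"
  show ?case
  proof (cases "D = {}")
    case True
    then have "ran g \<subseteq> P" using insert.prems(1) unfolding D_def ran_def by blast
    then show ?thesis using insert.IH insert.prems by blast
  next
    case False
    define g' where "g' = g |` (- D)"
    have "ran g' \<subseteq> P" using insert.prems(1) unfolding g'_def D_def ran_def
      by (auto simp: restrict_map_def)
    moreover have "\<And>a \<gamma>. g' a = Some \<gamma> \<Longrightarrow> \<gamma> \<in> BLP \<Phi> \<and> a \<in> prog_group \<gamma>"
      using insert.prems(3) by (auto simp: g'_def restrict_map_def split: if_splits)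
    ultimately obtain \<alpha> where \<alpha>: "\<alpha> \<in> BLP \<Phi>" "prog_pre \<alpha> = \<phi>" "prog_group \<alpha> = dom g'"
      "\<And>a. case g' a of None \<Rightarrow> a \<notin> gr (sem \<alpha>) | Some \<beta> \<Rightarrow> agent_bisimilar a (sem \<alpha>) (sem \<beta>)"
      using insert.IH[of g'] insert.prems(2) by blast
    \<comment> \<open>The restriction changes the precondition of \<open>\<beta>\<close> to
      \<open>\<phi>\<close> and cuts its group down to \<open>D\<close>, which is disjoint from the
      domain of \<open>g'\<close>. Both are side conditions of \<open>Cap\<close>.\<close>
    define \<rho> where "\<rho> = Restr \<phi> D \<beta>"
    have "\<beta> \<in> BLP \<Phi>" "D \<subseteq> prog_group \<beta>" using False insert.prems(3) unfolding D_def by blast+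
    then have \<rho>: "\<rho> \<in> BLP \<Phi>" unfolding \<rho>_def by (intro BLP.intros)
    have disj: "prog_group \<alpha> \<inter> prog_group \<rho> = {}" by (auto simp: \<alpha>(3) g'_def \<rho>_def)
    have C: "Cap \<alpha> \<rho> \<in> BLP \<Phi>"
      using \<alpha> \<rho> disj by (intro BLP.intros) (auto simp: \<rho>_def)
    have "case g a of None \<Rightarrow> a \<notin> gr (sem (Cap \<alpha> \<rho>))
        | Some \<beta> \<Rightarrow> agent_bisimilar a (sem (Cap \<alpha> \<rho>)) (sem \<beta>)" for a
    proof (cases "g a")
      case None
      then have "a \<notin> prog_group \<alpha>" "a \<notin> prog_group \<rho>"
        using \<alpha>(3) by (auto simp: g'_def \<rho>_def D_def restrict_map_def)
      then show ?thesis using None by (auto simp: gr_def cap_sem_def old_rel_def)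
    next
      case (Some \<gamma>)
      show ?thesis
      proof (cases "a \<in> D")
        case True
        then have "\<gamma> = \<beta>" using Some by (simp add: D_def)
        then have "a \<notin> prog_group \<alpha>" "a \<in> prog_group \<rho>" using disj True by (auto simp: \<rho>_def)
        then have "agent_bisimilar a (sem (Cap \<alpha> \<rho>)) (sem \<rho>)"
          using cap_sem_agent_right[OF wf_sem wf_sem] by simp
        moreover have "agent_bisimilar a (sem \<rho>) (sem \<beta>)"
          using restr_sem_agent[OF wf_sem True] by (simp add: \<rho>_def)
        ultimately show ?thesis using Some \<open>\<gamma> = \<beta>\<close> agent_bisimilar_trans by fastforce
      next
        case False
        then have g': "g' a = Some \<gamma>" using Some by (simp add: g'_def)
        then have "a \<in> prog_group \<alpha>" "a \<notin> prog_group \<rho>" using disj \<alpha>(3) by auto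
        then have "agent_bisimilar a (sem (Cap \<alpha> \<rho>)) (sem \<alpha>)"
          using cap_sem_agent_left[OF wf_sem wf_sem] by simp
        moreover have "agent_bisimilar a (sem \<alpha>) (sem \<gamma>)"
          using \<alpha>(4)[of a] g' by simp
        ultimately show ?thesis using Some agent_bisimilar_trans by fastforce
      qed
    qed
    moreover have "prog_group (Cap \<alpha> \<rho>) = dom g"
      using \<alpha>(3) by (auto simp: g'_def \<rho>_def D_def restrict_map_def split: if_splits)
    ultimately show ?thesis using C \<alpha>(2) by (intro bexI[of _ "Cap \<alpha> \<rho>"]) auto
  qed
qed


text \<open>Pair \<open>xs ! i\<close> with \<open>New i\<close>. Arrows for agents in
  \<open>B\<close> stay among these pairs by \<open>inn\<close> and \<open>closed\<close>. All other
  arrows enter component models, where \<open>out\<close> supplies successors that are already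
  bisimilar.\<close>

lemma learn_sem_bisimilar:
  assumes wf: "\<And>x. x \<in> set xs \<Longrightarrow> wf_pointed (F x)"
    and ev: "set xs \<subseteq> events N"
    and pr: "\<And>x. x \<in> set xs \<Longrightarrow> pre (fst (F x)) (snd (F x)) = pre N x"
    and inn: "\<And>x y a. x \<in> set xs \<Longrightarrow> y \<in> set xs \<Longrightarrow> a \<in> B \<Longrightarrow>
      agent_bisimilar a (F x) (F y) \<longleftrightarrow> (x, y) \<in> rel N a"
    and closed: "\<And>x y a. x \<in> set xs \<Longrightarrow> a \<in> B \<Longrightarrow> (x, y) \<in> rel N a \<Longrightarrow> y \<in> set xs"
    and out: "\<And>x a. x \<in> set xs \<Longrightarrow> a \<notin> B \<Longrightarrow> agent_bisimilar a (N, x) (F x)"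
    and i: "i < length xs"
  shows "(N, xs ! i) \<simeq> (fst (learn_sem B (map F xs)), New i)"
proof -
  let ?L = "fst (learn_sem B (map F xs))"
  let ?Z = "{(xs ! i, New i) | i. i < length xs}"
  have agent: "agent_bisimilar a (N, xs ! i) (?L, New i)" if "a \<notin> B" "i < length xs" for a i
  proof -
    have "agent_bisimilar a (?L, New i) (map F xs ! i)"
      by (rule learn_sem_agent) (use wf that in auto)
    then show ?thesis
      using out[of "xs ! i" a] that agent_bisimilar_sym agent_bisimilar_trans nth_map nth_mem
      by metis
  qed
  show ?thesis
  proof (rule bisimilar_coinduct[where Z = ?Z])
    show "(xs ! i, New i) \<in> ?Z" using i by blast
    show "?Z \<subseteq> events N \<times> events ?L"
      using ev by (auto simp: learn_sem_def)
  next
    fix x e assume "(x, e) \<in> ?Z"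
    then show "kd45_equiv (pre N x) (pre ?L e)"
      using pr by (auto simp: learn_sem_def)
  next
    fix x e a y assume Z: "(x, e) \<in> ?Z" and y: "(x, y) \<in> rel N a"
    from Z obtain i where i: "x = xs ! i" "e = New i" "i < length xs" by blast
    show "\<exists>e'. (e, e') \<in> rel ?L a \<and> ((y, e') \<in> ?Z \<or> (N, y) \<simeq> (?L, e'))"
    proof (cases "a \<in> B")
      case True
      then have "y \<in> set xs" using closed[of x a y] y i by simp
      then obtain j where j: "j < length xs" "y = xs ! j" by (auto simp: in_set_conv_nth)
      then have "(New i, New j) \<in> rel ?L a"
        using inn[of x y a] y i True by (simp add: learn_sem_rel_New_in)
      then show ?thesis using i j by blast
    next
      case False
      then show ?thesis using agent[of a i] i y unfolding agent_bisimilar_iff by auto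
    qed
  next
    fix x e a e' assume Z: "(x, e) \<in> ?Z" and e': "(e, e') \<in> rel ?L a"
    from Z obtain i where i: "x = xs ! i" "e = New i" "i < length xs" by blast
    show "\<exists>y. (x, y) \<in> rel N a \<and> ((y, e') \<in> ?Z \<or> (N, y) \<simeq> (?L, e'))"
    proof (cases "a \<in> B")
      case True
      then obtain j where j: "j < length xs" "e' = New j" "agent_bisimilar a (F x) (F (xs ! j))"
        using e' i by (auto simp: learn_sem_rel_New_in)
      then have "(x, xs ! j) \<in> rel N a" using inn[of x "xs ! j" a] i True by simp
      then show ?thesis using j by blast
    next
      case False
      then show ?thesis using agent[of a i] i e' unfolding agent_bisimilar_iff by auto
    qed
  qed
qed


section \<open>Labels\<close>

text \<open>A loop for the agents in \<open>D\<close>, followed by a chain of \<open>n\<close> loops for \<open>x\<close>, \<open>y\<close>, \<open>x\<close>, \<dots>; its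
  length is visible up to bisimilarity when \<open>x \<notin> D\<close> and \<open>x \<noteq> y\<close>.\<close>

primrec label :: "('a, 'p) fm \<Rightarrow> nat \<Rightarrow> 'a set \<Rightarrow> 'a \<Rightarrow> 'a \<Rightarrow> ('a, 'p) prog" where
  "label \<phi> 0 D x y = Learn D (Test \<phi>) []"
| "label \<phi> (Suc n) D x y = Learn D (Restr \<phi> {x} (label \<phi> n {x} y x)) []"

lemma prog_group_label: "D \<subseteq> prog_group (label \<phi> n D x y)"
  by (cases n) auto

lemma label_BLP: "\<phi> \<in> \<Phi> \<Longrightarrow> label \<phi> n D x y \<in> BLP \<Phi>"
proof (induction n arbitrary: D x y)
  case 0
  then show ?case by (auto intro!: BLP.intros)
next
  case (Suc n)
  then show ?case
    using prog_group_label[of "{x}" \<phi> n y x] by (auto intro!: BLP.intros)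
qed

lemma learn_single_loop:
  "a \<in> D \<Longrightarrow> (snd (sem (Learn D \<alpha> [])), t) \<in> rel (fst (sem (Learn D \<alpha> []))) a \<longleftrightarrow>
     t = snd (sem (Learn D \<alpha> []))"
  by (auto simp: learn_sem_rel_New_in bisimilar_agent)

lemma label_loop:
  assumes "a \<in> D"
  shows "(snd (sem (label \<phi> n D x y)), t) \<in> rel (fst (sem (label \<phi> n D x y))) a \<longleftrightarrow>
     t = snd (sem (label \<phi> n D x y))"
  using learn_single_loop[OF assms] by (cases n) (simp_all only: label.simps)

text \<open>Each of the two points has itself as its only \<open>a\<close>-successor.\<close>

lemma label_agent_iff:
  assumes "a \<in> D" "a \<in> D'"
  shows "agent_bisimilar a (sem (label \<phi> n D x y)) (sem (label \<phi> m D' x' y')) \<longleftrightarrow>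
     sem (label \<phi> n D x y) \<simeq> sem (label \<phi> m D' x' y')"
  unfolding agent_bisimilar_iff label_loop[OF assms(1)] label_loop[OF assms(2)] by simp

text \<open>As \<open>x\<close> is outside \<open>D\<close>, its arrows pass unchanged through the
  learning operator and the restriction, down to the chain shorter by one link.\<close>

lemma label_Suc_agent:
  assumes "x \<notin> D"
  shows "agent_bisimilar x (sem (label \<phi> (Suc n) D x y)) (sem (label \<phi> n {x} y x))"
proof -
  let ?R = "Restr \<phi> {x} (label \<phi> n {x} y x)"
  have "agent_bisimilar x (fst (learn_sem D [sem ?R]), New 0) (sem ?R)"
    using learn_sem_agent[of "[sem ?R]" 0 x D] assms wf_sem[of ?R] by auto
  moreover have "sem (label \<phi> (Suc n) D x y) = (fst (learn_sem D [sem ?R]), New 0)"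
    by (simp add: prod_eq_iff)
  moreover have "agent_bisimilar x (sem ?R) (sem (label \<phi> n {x} y x))"
    using restr_sem_agent[OF wf_sem singletonI] by simp
  ultimately show ?thesis using agent_bisimilar_trans by metis
qed

lemma agent_bisimilar_gr: "agent_bisimilar a M M' \<Longrightarrow> a \<in> gr M \<longleftrightarrow> a \<in> gr M'"
  unfolding agent_bisimilar_iff gr_def by blast

lemma label_gr_iff:
  assumes "x \<notin> D"
  shows "x \<in> gr (sem (label \<phi> n D x y)) \<longleftrightarrow> n \<noteq> 0"
proof (cases n)
  case 0
  then show ?thesis using assms by (auto simp: gr_def learn_sem_rel_New_notin test_sem_def)
next
  case (Suc m)
  have "x \<in> gr (sem (label \<phi> m {x} y x))"
    unfolding gr_def using label_loop[of x "{x}"] by blast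
  then show ?thesis
    using agent_bisimilar_gr[OF label_Suc_agent[OF assms]] Suc by blast
qed

text \<open>An \<open>x\<close>-arrow at the point shows whether a link is left
  (\<open>label_gr_iff\<close>). Following it removes one link from both chains and exchanges
  \<open>x\<close> and \<open>y\<close>; the loop set becomes \<open>{x}\<close>, which avoids the
  next agent \<open>y\<close>. Hence the generalisation over loop sets and agents.\<close>

lemma label_inj:
  assumes "sem (label \<phi> n D x y) \<simeq> sem (label \<phi> m D' x y)" "x \<notin> D" "x \<notin> D'" "x \<noteq> y"
  shows "n = m"
  using assms
proof (induction n arbitrary: m D D' x y)
  case 0
  have "x \<in> gr (sem (label \<phi> 0 D x y)) \<longleftrightarrow> x \<in> gr (sem (label \<phi> m D' x y))"
    by (rule agent_bisimilar_gr[OF bisimilar_agent[OF 0(1)]])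
  then show ?case using 0(2,3) by (simp add: label_gr_iff del: label.simps)
next
  case (Suc n)
  have "x \<in> gr (sem (label \<phi> (Suc n) D x y)) \<longleftrightarrow> x \<in> gr (sem (label \<phi> m D' x y))"
    by (rule agent_bisimilar_gr[OF bisimilar_agent[OF Suc(2)]])
  then have "m \<noteq> 0" using Suc(3,4) by (simp add: label_gr_iff del: label.simps)
  then obtain k where m: "m = Suc k" using not0_implies_Suc by blast
  have "agent_bisimilar x (sem (label \<phi> n {x} y x)) (sem (label \<phi> k {x} y x))"
    using label_Suc_agent[OF Suc(3)] label_Suc_agent[OF Suc(4)] bisimilar_agent[OF Suc(2), of x]
    unfolding m by (meson agent_bisimilar_sym agent_bisimilar_trans)
  then have "sem (label \<phi> n {x} y x) \<simeq> sem (label \<phi> k {x} y x)"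
    by (simp only: label_agent_iff singletonI)
  moreover have "y \<notin> {x}" "y \<noteq> x" using Suc(5) by auto
  ultimately show ?case using Suc.IH m by blast
qed


lemma label_bisimilar_iff:
  assumes "a \<in> D" "x \<notin> D" "x \<noteq> y"
  shows "agent_bisimilar a (sem (label \<phi> n D x y)) (sem (label \<phi> m D x y)) \<longleftrightarrow> n = m"
proof
  assume "agent_bisimilar a (sem (label \<phi> n D x y)) (sem (label \<phi> m D x y))"
  then have "sem (label \<phi> n D x y) \<simeq> sem (label \<phi> m D x y)"
    by (simp only: label_agent_iff[OF assms(1,1)])
  then show "n = m" by (rule label_inj) fact+
next
  assume "n = m"
  then show "agent_bisimilar a (sem (label \<phi> n D x y)) (sem (label \<phi> m D x y))"
    using bisimilar_agent[OF sem_bisimilar_refl] by metis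
qed


section \<open>Trees are acyclic\<close>

lemma rtrancl_distinct_path:
  assumes "(u, v) \<in> E\<^sup>*"
  shows "\<exists>p. p \<noteq> [] \<and> hd p = u \<and> last p = v \<and> distinct p \<and> set p \<subseteq> insert u (Range E) \<and>
    successively (\<lambda>x y. (x, y) \<in> E) p"
  using assms
proof (induction rule: rtrancl_induct)
  case base
  then show ?case by (intro exI[of _ "[u]"]) auto
next
  case (step v w)
  then obtain p where p: "p \<noteq> []" "hd p = u" "last p = v" "distinct p"
    "set p \<subseteq> insert u (Range E)" "successively (\<lambda>x y. (x, y) \<in> E) p" by blast
  show ?case
  proof (cases "w \<in> set p")
    case True
    \<comment> \<open>If the path already visits \<open>w\<close>, it is cut off there.\<close>
    then obtain q r where qr: "p = q @ w # r" by (meson split_list)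
    then have "successively (\<lambda>x y. (x, y) \<in> E) (q @ [w])" "hd (q @ [w]) = u"
      using p(2,6) by (auto simp: successively_append_iff hd_append split: if_splits)
    then show ?thesis using p(4,5) qr by (intro exI[of _ "q @ [w]"]) auto
  next
    case False
    then show ?thesis using p step.hyps(2)
      by (intro exI[of _ "p @ [w]"]) (auto simp: successively_append_iff)
  qed
qed

text \<open>Let \<open>(v, u)\<close> be the last edge of a directed cycle through \<open>u\<close>.
  The directed path from \<open>u\<close> to \<open>v\<close> and that edge walked backwards are
  both simple paths from \<open>u\<close> to \<open>v\<close>. If they coincide,
  \<open>(u, v)\<close> and \<open>(v, u)\<close> are opposite edges.\<close>

lemma finite_tree_acyclic:
  assumes "finite_tree V E"
  shows "acyclic E"
  unfolding acyclic_def
proof (intro allI notI)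
  fix u assume "(u, u) \<in> E\<^sup>+"
  then obtain v where v: "(u, v) \<in> E\<^sup>*" "(v, u) \<in> E" by (meson tranclD2)
  have sub: "E \<subseteq> V \<times> V" and asym: "(u, v) \<notin> E"
    and uniq: "\<And>u v. u \<in> V \<Longrightarrow> v \<in> V \<Longrightarrow> \<exists>!p. simple_path V E u p v"
    using assms v(2) unfolding finite_tree_def by blast+
  \<comment> \<open>A loop would be its own opposite edge, hence
    \<open>u \<noteq> v\<close>.\<close>
  have uv: "u \<in> V" "v \<in> V" "u \<noteq> v" using sub v(2) asym by auto
  obtain p where p: "p \<noteq> []" "hd p = u" "last p = v" "distinct p"
    "set p \<subseteq> insert u (Range E)" "successively (\<lambda>x y. (x, y) \<in> E) p"
    using rtrancl_distinct_path[OF v(1)] by blast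
  have "simple_path V E u p v"
    unfolding simple_path_def
    using p sub uv(1) successively_mono[OF p(6), of "\<lambda>x y. (x, y) \<in> E \<union> E\<inverse>"] by blast
  moreover have "simple_path V E u [u, v] v"
    using uv v(2) by (simp add: simple_path_def)
  ultimately have "p = [u, v]" using uniq[OF uv(1,2)] by blast
  then show False using p(6) asym by simp
qed


section \<open>Programs for the nodes of the graph\<close>

text \<open>Acyclicity is the form in which the tree hypothesis enters: it excludes opposite edges,
  and with finiteness it makes the converse edge relation well-founded.\<close>

locale acyclic_K45 =
  fixes N :: "('e, 'a, 'p) act_model"
  assumes am: "action_model N" and fin: "finite (events N)" and K45: "K45 N"
    and acyc: "acyclic (G_edges N)"
begin

lemma rel_events: "(s, t) \<in> rel N a \<Longrightarrow> s \<in> events N \<and> t \<in> events N"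
  using am unfolding action_model_def by blast

lemma rel_trans: "(s, t) \<in> rel N a \<Longrightarrow> (t, u) \<in> rel N a \<Longrightarrow> (s, u) \<in> rel N a"
  using K45 unfolding K45_def by (meson transD)

lemma rel_eucl: "(s, t) \<in> rel N a \<Longrightarrow> (s, u) \<in> rel N a \<Longrightarrow> (t, u) \<in> rel N a"
  using K45 unfolding K45_def euclidean_def by blast

lemma rel_successors: "(s, t) \<in> rel N a \<Longrightarrow> rel N a `` {s} = rel N a `` {t}"
  using rel_trans rel_eucl by blast

lemma sub_rel_iff:
  "(s, t) \<in> sub_rel N M a \<longleftrightarrow> a \<in> snd M \<and> s \<in> fst M \<and> t \<in> fst M \<and> (s, t) \<in> rel N a"
  by (auto simp: sub_rel_def)

text \<open>Transitivity and Euclideanness are inherited from \<open>N\<close>, so being S5 reduces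
  to having loops.\<close>

lemma ccS5_iff:
  "M \<in> ccS5 N \<longleftrightarrow> fst M \<noteq> {} \<and> fst M \<subseteq> events N \<and>
     (\<forall>a \<in> snd M. \<forall>s \<in> fst M. (s, s) \<in> rel N a) \<and> connected_sub N M \<and> closed_sub N M"
proof -
  have "trans (sub_rel N M a)" for a
    using rel_trans unfolding trans_def sub_rel_iff by blast
  moreover have "euclidean (sub_rel N M a)" for a
    using rel_eucl unfolding euclidean_def sub_rel_iff by blast
  moreover have "refl_on (fst M) (sub_rel N M a) \<longleftrightarrow> (\<forall>s \<in> fst M. (s, s) \<in> rel N a)"
    if "a \<in> snd M" for a
    using that by (auto simp: refl_on_def sub_rel_def)
  ultimately show ?thesis unfolding ccS5_def S5_sub_def by auto
qed

text \<open>The agents may be infinite in number, so only the number of events is maximised. For an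
  event set \<open>S\<close> of greatest size, the agents are then enlarged as far as possible at
  once.\<close>

lemma ex_max_ccS5:
  assumes M: "M \<in> ccS5 N"
  shows "\<exists>M' \<in> max_ccS5 N. sub_le M M'"
proof -
  define P where "P S \<longleftrightarrow> (\<exists>B. (S, B) \<in> ccS5 N \<and> sub_le M (S, B))" for S
  have 1: "P (fst M)" unfolding P_def using M by (intro exI[of _ "snd M"]) (simp add: sub_le_def)
  have 2: "\<forall>S. P S \<longrightarrow> card S < Suc (card (events N))"
    by (auto simp: P_def ccS5_iff less_Suc_eq_le intro!: card_mono fin)
  obtain S where S: "P S" and greatest: "\<And>S'. P S' \<Longrightarrow> card S' \<le> card S"
    using ex_has_greatest_nat[of P, OF 1 2] by blast
  then obtain B where B: "(S, B) \<in> ccS5 N" "sub_le M (S, B)" unfolding P_def by blast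
  \<comment> \<open>These are all the agents that any closed S5 submodel on \<open>S\<close> can
    have. Adding agents preserves connectedness, so \<open>(S, C)\<close> is itself an admissible
    submodel.\<close>
  define C where "C = {a. \<forall>s \<in> S. (s, s) \<in> rel N a \<and> (\<forall>t. (s, t) \<in> rel N a \<longrightarrow> t \<in> S)}"
  have "B \<subseteq> C" using B(1) unfolding ccS5_iff closed_sub_def C_def by auto
  then have "(\<Union>a \<in> B. sub_rel N (S, B) a) \<subseteq> (\<Union>a \<in> C. sub_rel N (S, C) a)"
    by (auto simp: sub_rel_def)
  then have mono: "p \<in> (\<Union>a \<in> B. sub_rel N (S, B) a)\<^sup>+ \<Longrightarrow> p \<in> (\<Union>a \<in> C. sub_rel N (S, C) a)\<^sup>+" for p
    by (rule trancl_mono[rotated])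
  have "connected_sub N (S, B)" using B(1) by (simp add: ccS5_iff)
  then have "connected_sub N (S, C)" by (simp add: connected_sub_def mono)
  moreover have "closed_sub N (S, C)" by (auto simp: closed_sub_def C_def)
  moreover have "\<forall>a \<in> C. \<forall>s \<in> S. (s, s) \<in> rel N a" by (auto simp: C_def)
  moreover have "S \<noteq> {} \<and> S \<subseteq> events N" using B(1) by (simp add: ccS5_iff)
  ultimately have SC: "(S, C) \<in> ccS5 N" by (simp add: ccS5_iff)
  have le: "sub_le M (S, C)" using B(2) \<open>B \<subseteq> C\<close> by (auto simp: sub_le_def)
  have "M' = (S, C)" if M': "M' \<in> ccS5 N" "sub_le (S, C) M'" for M'
  proof -
    have "P (fst M')"
      unfolding P_def using M' le by (intro exI[of _ "snd M'"]) (auto simp: sub_le_def)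
    then have "card (fst M') \<le> card S" by (rule greatest)
    moreover have "finite (fst M')" using M'(1) fin finite_subset by (auto simp: ccS5_iff)
    ultimately have "S = fst M'" using M'(2) card_seteq by (auto simp: sub_le_def)
    moreover have "snd M' \<subseteq> C"
      using M'(1) \<open>S = fst M'\<close> unfolding ccS5_iff closed_sub_def C_def by auto
    ultimately show ?thesis using M'(2) by (auto simp: sub_le_def prod_eq_iff)
  qed
  then have "(S, C) \<in> max_ccS5 N" using SC by (simp add: max_ccS5_def)
  then show ?thesis using le by blast
qed

lemma max_node:
  assumes "M \<in> max_ccS5 N"
  shows "fst M \<subseteq> events N" "fst M \<noteq> {}" "connected_sub N M"
    "\<And>a s. a \<in> snd M \<Longrightarrow> s \<in> fst M \<Longrightarrow> (s, s) \<in> rel N a"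
    "\<And>a s t. a \<in> snd M \<Longrightarrow> s \<in> fst M \<Longrightarrow> (s, t) \<in> rel N a \<Longrightarrow> t \<in> fst M"
  using assms unfolding max_ccS5_def ccS5_iff closed_sub_def by blast+

section \<open>Nodes, their overlaps and the arrows between them\<close>

lemma edgeI:
  assumes "M \<in> max_ccS5 N" "M' \<in> max_ccS5 N" "s \<in> fst M" "t \<in> fst M'"
    "(s, t) \<in> rel N a" "a \<notin> snd M" "a \<in> snd M'"
  shows "(M, M') \<in> G_edges N"
  using assms unfolding G_edges_def T_model_def by fastforce

lemma no_opposite_edges: "(M, M') \<in> G_edges N \<Longrightarrow> (M', M) \<notin> G_edges N"
  using acyc unfolding acyclic_def by (meson trancl.simps)

text \<open>\<open>M'\<close> is closed under the agents of \<open>M\<close>, so a chain of arrows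
  connecting \<open>s\<close> to an event of \<open>M\<close> never leaves \<open>M'\<close>. Hence
  \<open>M\<close> lies below \<open>M'\<close>, and maximality applies.\<close>

lemma max_ccS5_le:
  assumes M: "M \<in> max_ccS5 N" and M': "M' \<in> max_ccS5 N" and s: "s \<in> fst M" "s \<in> fst M'"
    and sub: "snd M \<subseteq> snd M'"
  shows "M = M'"
proof -
  have "t \<in> fst M'" if t: "t \<in> fst M" for t
  proof (cases "s = t")
    case True
    then show ?thesis using s by simp
  next
    case False
    then have "(s, t) \<in> (\<Union>a \<in> snd M. sub_rel N M a)\<^sup>+"
      using max_node(3)[OF M] s t unfolding connected_sub_def by blast
    then show ?thesis
    proof (induction rule: trancl_induct)
      case (base y)
      then show ?case using max_node(5)[OF M'] s(2) sub by (auto simp: sub_rel_def split: if_splits)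
    next
      case (step y z)
      then show ?case using max_node(5)[OF M'] sub by (auto simp: sub_rel_def split: if_splits)
    qed
  qed
  then have "sub_le M M'" using sub by (auto simp: sub_le_def)
  then show ?thesis using M M' unfolding max_ccS5_def by blast
qed

text \<open>Two overlapping nodes would be joined by edges in both directions, given by the loops of a
  common event.\<close>

lemma max_ccS5_unique:
  assumes M: "M \<in> max_ccS5 N" and M': "M' \<in> max_ccS5 N" and s: "s \<in> fst M" "s \<in> fst M'"
  shows "M = M'"
proof (rule ccontr)
  assume ne: "M \<noteq> M'"
  \<comment> \<open>By \<open>max_ccS5_le\<close>, neither node's agent set contains the
    other's.\<close>
  obtain a where a: "a \<in> snd M" "a \<notin> snd M'" using max_ccS5_le[OF M M' s] ne by blast
  obtain b where b: "b \<in> snd M'" "b \<notin> snd M" using max_ccS5_le[OF M' M s(2,1)] ne by blast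
  show False
    using edgeI[OF M M' s max_node(4)[OF M' b(1) s(2)] b(2,1)]
      edgeI[OF M' M s(2,1) max_node(4)[OF M a(1) s(1)] a(2,1)] no_opposite_edges by blast
qed

lemma ex_node:
  assumes "s \<in> events N"
  shows "\<exists>M \<in> max_ccS5 N. s \<in> fst M"
proof -
  \<comment> \<open>A single event without agents satisfies the S5, connectedness and closure
    conditions trivially.\<close>
  have "({s}, {}) \<in> ccS5 N"
    using assms by (simp add: ccS5_iff connected_sub_def closed_sub_def)
  then show ?thesis using ex_max_ccS5 unfolding sub_le_def by fastforce
qed

text \<open>In a K45 model the \<open>a\<close>-successors of a target \<open>t\<close> form a
  cluster around \<open>t\<close> on which the relation is total. With the agent \<open>a\<close>
  alone this is a closed connected S5 submodel. A maximal one above it shares \<open>t\<close> with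
  \<open>M\<close>, so it equals \<open>M\<close>.\<close>

lemma agent_of_target:
  assumes M: "M \<in> max_ccS5 N" and t: "t \<in> fst M" and st: "(s, t) \<in> rel N a"
  shows "a \<in> snd M"
proof -
  let ?T = "rel N a `` {t}"
  have tt: "t \<in> ?T" using rel_eucl[OF st st] by simp
  have all: "(u, v) \<in> rel N a" if "u \<in> ?T" "v \<in> ?T" for u v
    using that rel_eucl by blast
  have "connected_sub N (?T, {a})"
    using all by (auto simp: connected_sub_def sub_rel_iff intro!: r_into_trancl)
  moreover have "closed_sub N (?T, {a})"
    using rel_trans unfolding closed_sub_def by auto
  moreover have "?T \<subseteq> events N" "\<forall>u \<in> ?T. (u, u) \<in> rel N a"
    using rel_events all by blast+
  ultimately have "(?T, {a}) \<in> ccS5 N"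
    using tt unfolding ccS5_iff by auto
  then obtain M' where M': "M' \<in> max_ccS5 N" "?T \<subseteq> fst M'" "a \<in> snd M'"
    using ex_max_ccS5 unfolding sub_le_def by fastforce
  then have "M' = M" using max_ccS5_unique[OF M'(1) M] tt t by blast
  then show ?thesis using M' by simp
qed

text \<open>By \<open>agent_of_target\<close>, \<open>a\<close> is an agent of the node of
  \<open>t\<close>. That node therefore differs from \<open>M\<close>, and the arrow yields an
  edge.\<close>

lemma edge_of_successor:
  assumes M: "M \<in> max_ccS5 N" and s: "s \<in> fst M" and st: "(s, t) \<in> rel N a" and a: "a \<notin> snd M"
  shows "\<exists>M'. (M, M') \<in> G_edges N \<and> t \<in> fst M'"
proof -
  obtain M' where M': "M' \<in> max_ccS5 N" "t \<in> fst M'" using ex_node rel_events[OF st] by blast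
  then show ?thesis using edgeI[OF M M'(1) s M'(2) st a] agent_of_target[OF M' st] by blast
qed

lemma single_agent_total:
  assumes M: "M \<in> max_ccS5 N" and a: "snd M = {a}" and s: "s \<in> fst M" "t \<in> fst M"
  shows "(s, t) \<in> rel N a"
proof (cases "s = t")
  case True
  then show ?thesis using max_node(4)[OF M] a s by simp
next
  case False
  then have "(s, t) \<in> (sub_rel N M a)\<^sup>+"
    using max_node(3)[OF M] s a unfolding connected_sub_def by fastforce
  moreover have "trans (sub_rel N M a)"
    using rel_trans unfolding trans_def sub_rel_iff by blast
  ultimately show ?thesis by (simp add: sub_rel_def split: if_splits)
qed

text \<open>\<open>D\<close> collects the agents whose clusters are told apart by labels. Finiteness
  of the label set is what \<open>assemble\<close> asks for.\<close>

lemma cluster_labels: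
  assumes M: "M \<in> max_ccS5 N" and \<phi>: "\<phi> \<in> \<Phi>"
  shows "\<exists>D l. D \<subseteq> snd M \<and> finite {l a s | a s. a \<in> D \<and> s \<in> fst M} \<and>
    (\<forall>a \<in> D. \<forall>s \<in> fst M. l a s \<in> BLP \<Phi> \<and> a \<in> prog_group (l a s)) \<and>
    (\<forall>a \<in> D. \<forall>s \<in> fst M. \<forall>t \<in> fst M.
       agent_bisimilar a (sem (l a s)) (sem (l a t)) \<longleftrightarrow> (s, t) \<in> rel N a) \<and>
    (\<forall>a \<in> snd M - D. \<forall>s \<in> fst M. \<forall>t \<in> fst M. (s, t) \<in> rel N a)"
proof (cases "\<exists>x \<in> snd M. \<exists>y \<in> snd M. x \<noteq> y")
  case False
  then have "\<forall>a \<in> snd M - {}. \<forall>s \<in> fst M. \<forall>t \<in> fst M. (s, t) \<in> rel N a"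
    using single_agent_total[OF M] by blast
  \<comment> \<open>With at most one agent in the node there is nothing to distinguish, so no labels
    are handed out.\<close>
  then show ?thesis by (intro exI[of _ "{}"]) auto
next
  case True
  then obtain x y where xy: "x \<in> snd M" "y \<in> snd M" "x \<noteq> y" by blast
  have finM: "finite (fst M)" using max_node(1)[OF M] fin finite_subset by blast
  obtain h :: "'e set \<Rightarrow> nat" where h: "inj_on h (Pow (fst M))"
    using finite_imp_inj_to_nat_seg[of "Pow (fst M)"] finM by auto
  \<comment> \<open>The cluster of \<open>s\<close>, given by its successor set, is coded as a chain
    length.\<close>
  define k where "k a s = h (rel N a `` {s})" for a s
  \<comment> \<open>The point needs a loop for \<open>a\<close>, but none for the agent that starts
    the chain. So chains start with \<open>x\<close>, except for the labels of \<open>x\<close>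
    itself, which start with \<open>y\<close>.\<close>
  define l where "l a s = (if a = x then label \<phi> (k a s) {x} y x
     else label \<phi> (k a s) (snd M - {x}) x y)" for a s
  have k_iff: "k a s = k a t \<longleftrightarrow> (s, t) \<in> rel N a"
    if "a \<in> snd M" "s \<in> fst M" "t \<in> fst M" for a s t
  proof -
    have "rel N a `` {s} \<in> Pow (fst M)" "rel N a `` {t} \<in> Pow (fst M)"
      using that max_node(5)[OF M] by blast+
    then have "k a s = k a t \<longleftrightarrow> rel N a `` {s} = rel N a `` {t}"
      unfolding k_def using h by (auto dest: inj_onD)
    also have "\<dots> \<longleftrightarrow> (s, t) \<in> rel N a"
      using rel_successors max_node(4)[OF M that(1,3)] by blast
    finally show ?thesis .
  qed
  have "k a s \<in> h ` Pow (fst M)" if "a \<in> snd M" "s \<in> fst M" for a s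
    using that max_node(5)[OF M] unfolding k_def by blast
  then have "{l a s | a s. a \<in> snd M \<and> s \<in> fst M} \<subseteq>
      (\<lambda>n. label \<phi> n {x} y x) ` h ` Pow (fst M) \<union>
      (\<lambda>n. label \<phi> n (snd M - {x}) x y) ` h ` Pow (fst M)"
    unfolding l_def by auto
  then have fin_l: "finite {l a s | a s. a \<in> snd M \<and> s \<in> fst M}"
    using finM by (meson finite_Pow_iff finite_UnI finite_imageI finite_subset)
  have BLP_l: "l a s \<in> BLP \<Phi> \<and> a \<in> prog_group (l a s)" if "a \<in> snd M" for a s
  proof (cases "a = x")
    case True
    then show ?thesis using label_BLP[OF \<phi>] prog_group_label[of "{x}"] by (simp add: l_def)
  next
    case False
    then have "a \<in> snd M - {x}" using that by simp
    then show ?thesis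
      using False label_BLP[OF \<phi>] subsetD[OF prog_group_label, of a "snd M - {x}"]
      by (simp add: l_def)
  qed
  have bisim_l: "agent_bisimilar a (sem (l a s)) (sem (l a t)) \<longleftrightarrow> (s, t) \<in> rel N a"
    if "a \<in> snd M" "s \<in> fst M" "t \<in> fst M" for a s t
  proof -
    have "agent_bisimilar a (sem (l a s)) (sem (l a t)) \<longleftrightarrow> k a s = k a t"
    proof (cases "a = x")
      case True
      then have "l a s = label \<phi> (k a s) {x} y x" "l a t = label \<phi> (k a t) {x} y x"
        by (simp_all add: l_def)
      then show ?thesis
        using label_bisimilar_iff[of a "{x}" y x] True xy(3) by simp
    next
      case False
      then have "a \<in> snd M - {x}" using that by simp
      moreover have "l a s = label \<phi> (k a s) (snd M - {x}) x y"
        "l a t = label \<phi> (k a t) (snd M - {x}) x y"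
        using False by (simp_all add: l_def)
      ultimately show ?thesis
        using label_bisimilar_iff[of a "snd M - {x}" x y] xy(3) by simp
    qed
    then show ?thesis using k_iff[OF that] by simp
  qed
  show ?thesis
    using fin_l BLP_l bisim_l by (intro exI[of _ "snd M"] exI[of _ l]) blast
qed

text \<open>The inclusion of \<open>gr\<close> in \<open>prog_group\<close> is carried along because
  a restriction to \<open>B\<close> is a program only if \<open>B\<close> lies in the group of its
  argument.\<close>

lemma node_programs:
  assumes \<Phi>: "pre N ` events N \<subseteq> \<Phi>" and M: "M \<in> max_ccS5 N"
    and IH: "\<And>M' t. (M, M') \<in> G_edges N \<Longrightarrow> t \<in> fst M' \<Longrightarrow>
      \<exists>\<alpha> \<in> BLP \<Phi>. (N, t) \<simeq> sem \<alpha> \<and> gr (N, t) \<subseteq> prog_group \<alpha>"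
    and s: "s \<in> fst M"
  shows "\<exists>\<alpha> \<in> BLP \<Phi>. (N, s) \<simeq> sem \<alpha> \<and> gr (N, s) \<subseteq> prog_group \<alpha>"
proof -
  define out where "out t \<longleftrightarrow> (\<exists>M'. (M, M') \<in> G_edges N \<and> t \<in> fst M')" for t
  have "\<exists>\<alpha>. out t \<longrightarrow> \<alpha> \<in> BLP \<Phi> \<and> (N, t) \<simeq> sem \<alpha> \<and> gr (N, t) \<subseteq> prog_group \<alpha>" for t
    using IH unfolding out_def by blast
  then obtain \<beta> where \<beta>: "\<And>t. out t \<Longrightarrow> \<beta> t \<in> BLP \<Phi>"
    "\<And>t. out t \<Longrightarrow> (N, t) \<simeq> sem (\<beta> t)" "\<And>t. out t \<Longrightarrow> gr (N, t) \<subseteq> prog_group (\<beta> t)"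
    by metis
  have "pre N s \<in> \<Phi>" using \<Phi> s max_node(1)[OF M] by blast
  then obtain D l where D: "D \<subseteq> snd M" and fin_l: "finite {l a s | a s. a \<in> D \<and> s \<in> fst M}"
    and BLP_l: "\<And>a s. a \<in> D \<Longrightarrow> s \<in> fst M \<Longrightarrow> l a s \<in> BLP \<Phi> \<and> a \<in> prog_group (l a s)"
    and bisim_l: "\<And>a s t. a \<in> D \<Longrightarrow> s \<in> fst M \<Longrightarrow> t \<in> fst M \<Longrightarrow>
       agent_bisimilar a (sem (l a s)) (sem (l a t)) \<longleftrightarrow> (s, t) \<in> rel N a"
    and total: "\<And>a s t. a \<in> snd M \<Longrightarrow> a \<notin> D \<Longrightarrow> s \<in> fst M \<Longrightarrow> t \<in> fst M \<Longrightarrow> (s, t) \<in> rel N a"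
    using cluster_labels[OF M] by (smt (verit) DiffI)
  \<comment> \<open>One representative target per event and agent is enough: it has the same
    \<open>a\<close>-successors as \<open>s\<close>, so its program already has the
    \<open>a\<close>-arrows wanted at \<open>s\<close>.\<close>
  define c where "c s a = (SOME t. (s, t) \<in> rel N a)" for s a
  have c: "(s, c s a) \<in> rel N a" if "a \<in> gr (N, s)" for s a
    using that someI_ex[of "\<lambda>t. (s, t) \<in> rel N a"] unfolding c_def gr_def by auto
  \<comment> \<open>Agents in \<open>D\<close> get labels, agents outside the node with an arrow get
    the representative's program. For node agents outside \<open>D\<close>, \<open>None\<close>
    leaves no arrows.\<close>
  define g where "g s a = (if a \<in> D then Some (l a s)
     else if a \<notin> snd M \<and> a \<in> gr (N, s) then Some (\<beta> (c s a)) else None)" for s a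
  let ?P = "{l a s | a s. a \<in> D \<and> s \<in> fst M} \<union> \<beta> ` events N"
  have "\<exists>\<alpha> \<in> BLP \<Phi>. prog_pre \<alpha> = pre N t \<and> prog_group \<alpha> = dom (g t) \<and>
     (\<forall>a. case g t a of None \<Rightarrow> a \<notin> gr (sem \<alpha>) | Some \<beta> \<Rightarrow> agent_bisimilar a (sem \<alpha>) (sem \<beta>))"
    if t: "t \<in> fst M" for t
  proof (rule assemble[of ?P])
    show "finite ?P" using fin_l fin by blast
    show "ran (g t) \<subseteq> ?P"
      using t c rel_events unfolding ran_def g_def by (fastforce split: if_splits)
    show "pre N t \<in> \<Phi>" using \<Phi> t max_node(1)[OF M] by blast
    fix a \<gamma> assume a: "g t a = Some \<gamma>"
    show "\<gamma> \<in> BLP \<Phi> \<and> a \<in> prog_group \<gamma>"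
    proof (cases "a \<in> D")
      case True
      then show ?thesis using a BLP_l t by (auto simp: g_def)
    next
      case False
      then have *: "a \<notin> snd M" "a \<in> gr (N, t)" "\<gamma> = \<beta> (c t a)"
        using a by (auto simp: g_def split: if_splits)
      have "out (c t a)"
        using edge_of_successor[OF M t c[OF *(2)] *(1)] unfolding out_def .
      moreover have "a \<in> gr (N, c t a)"
        \<comment> \<open>Being a target, the representative has an \<open>a\<close>-loop, so
          \<open>a\<close> is in its \<open>gr\<close> and hence in the group of its
          program.\<close>
        using rel_eucl[OF c[OF *(2)] c[OF *(2)]] unfolding gr_def by auto
      ultimately show ?thesis using \<beta> *(3) by blast
    qed
  qed
  then obtain A where A: "\<And>t. t \<in> fst M \<Longrightarrow> A t \<in> BLP \<Phi>" "\<And>t. t \<in> fst M \<Longrightarrow> prog_pre (A t) = pre N t"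
    "\<And>t. t \<in> fst M \<Longrightarrow> prog_group (A t) = dom (g t)"
    "\<And>t a. t \<in> fst M \<Longrightarrow> case g t a of None \<Rightarrow> a \<notin> gr (sem (A t))
       | Some \<gamma> \<Rightarrow> agent_bisimilar a (sem (A t)) (sem \<gamma>)"
    by metis
  have inn: "agent_bisimilar a (sem (A t)) (sem (A u)) \<longleftrightarrow> (t, u) \<in> rel N a"
    if "t \<in> fst M" "u \<in> fst M" "a \<in> snd M" for t u a
  proof (cases "a \<in> D")
    case True
    then have "agent_bisimilar a (sem (A t)) (sem (l a t))"
      "agent_bisimilar a (sem (A u)) (sem (l a u))"
      using A(4)[OF that(1), of a] A(4)[OF that(2), of a] by (simp_all add: g_def)
    then show ?thesis
      using bisim_l[OF True that(1,2)] agent_bisimilar_sym agent_bisimilar_trans by metis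
  next
    case False
    \<comment> \<open>Without \<open>a\<close>-arrows on either side \<open>a\<close>-bisimilarity
      holds vacuously, in agreement with the total relation of \<open>a\<close> on the node.\<close>
    then have "a \<notin> gr (sem (A t))" "a \<notin> gr (sem (A u))"
      using A(4)[OF that(1), of a] A(4)[OF that(2), of a] that(3) by (simp_all add: g_def)
    then show ?thesis
      using total[OF that(3) False that(1,2)] by (auto simp: agent_bisimilar_iff gr_def)
  qed
  have outer: "agent_bisimilar a (N, t) (sem (A t))" if t: "t \<in> fst M" and a: "a \<notin> snd M" for t a
  proof (cases "a \<in> gr (N, t)")
    case True
    have "out (c t a)"
      using edge_of_successor[OF M t c[OF True] a] unfolding out_def .
    then have "agent_bisimilar a (N, c t a) (sem (\<beta> (c t a)))"
      by (rule bisimilar_agent[OF \<beta>(2)])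
    moreover have "agent_bisimilar a (N, t) (N, c t a)"
      by (rule agent_bisimilar_same_successors[OF am rel_successors[OF c[OF True]]])
    moreover have "g t a = Some (\<beta> (c t a))" using a D True by (auto simp: g_def)
    then have "agent_bisimilar a (sem (A t)) (sem (\<beta> (c t a)))" using A(4)[OF t, of a] by simp
    ultimately show ?thesis using agent_bisimilar_sym agent_bisimilar_trans by metis
  next
    case False
    then have "g t a = None" using a D by (auto simp: g_def)
    then have "a \<notin> gr (sem (A t))" using A(4)[OF t, of a] by simp
    then show ?thesis using False by (auto simp: agent_bisimilar_iff gr_def)
  qed
  have "finite (fst M - {s})"
    using finite_subset[OF max_node(1)[OF M] fin] by (rule finite_Diff)
  then obtain ys where ys: "set ys = fst M - {s}" by (meson finite_list)
  \<comment> \<open>The event \<open>s\<close> comes first, since the actual event of a learning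
    program is \<open>New 0\<close>.\<close>
  define xs where "xs = s # ys"
  have set_xs: "set xs = fst M" using s by (simp add: xs_def ys insert_absorb)
  let ?\<alpha> = "Learn (snd M) (A s) (map A ys)"
  have "?\<alpha> \<in> BLP \<Phi>" using A(1) s ys by (auto intro!: BLP.intros)
  moreover have "(N, s) \<simeq> sem ?\<alpha>"
  proof -
    have "(N, xs ! 0) \<simeq> (fst (learn_sem (snd M) (map (\<lambda>t. sem (A t)) xs)), New 0)"
    proof (rule learn_sem_bisimilar, unfold set_xs)
      show "fst M \<subseteq> events N" by (rule max_node(1)[OF M])
    next
      fix t assume "t \<in> fst M"
      then show "pre (fst (sem (A t))) (snd (sem (A t))) = pre N t"
        by (simp add: pre_sem A(2))
    next
      fix t u a assume "t \<in> fst M" "a \<in> snd M" "(t, u) \<in> rel N a"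
      then show "u \<in> fst M" using max_node(5)[OF M] by blast
    qed (simp_all add: wf_sem inn outer xs_def)
    moreover have "sem ?\<alpha> = (fst (learn_sem (snd M) (map (\<lambda>t. sem (A t)) xs)), New 0)"
      by (simp add: prod_eq_iff comp_def xs_def)
    moreover have "xs ! 0 = s" by (simp add: xs_def)
    ultimately show ?thesis by simp
  qed
  moreover have "gr (N, s) \<subseteq> prog_group ?\<alpha>"
    using A(3)[OF s] by (auto simp: g_def split: if_splits)
  ultimately show ?thesis by blast
qed

lemma ex_program:
  assumes \<Phi>: "pre N ` events N \<subseteq> \<Phi>" and s: "s \<in> events N"
  shows "\<exists>\<alpha> \<in> BLP \<Phi>. (N, s) \<simeq> sem \<alpha>"
proof -
  \<comment> \<open>Agent sets may be infinite; finiteness of the set of nodes comes from their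
    being determined by their event sets.\<close>
  have fst_inj: "inj_on fst (max_ccS5 N)"
  proof (rule inj_onI)
    fix M M' assume *: "M \<in> max_ccS5 N" "M' \<in> max_ccS5 N" "fst M = fst M'"
    obtain t where "t \<in> fst M" using max_node(2)[OF *(1)] by blast
    then show "M = M'" using max_ccS5_unique[OF *(1,2)] *(3) by simp
  qed
  have "finite (fst ` max_ccS5 N)"
    by (rule finite_subset[of _ "Pow (events N)"]) (use fin max_node(1) in \<open>blast+\<close>)
  then have "finite (max_ccS5 N)" using fst_inj finite_imageD by blast
  moreover have "G_edges N \<subseteq> max_ccS5 N \<times> max_ccS5 N" by (auto simp: G_edges_def)
  ultimately have "finite (G_edges N)" by (meson finite_SigmaI finite_subset)
  \<comment> \<open>The converse relation makes the induction start at nodes without outgoing edges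
    and assume programs for all targets of edges.\<close>
  then have wf: "wf ((G_edges N)\<inverse>)" using acyc by (rule finite_acyclic_wf_converse)
  have "\<forall>s \<in> fst M. \<exists>\<alpha> \<in> BLP \<Phi>. (N, s) \<simeq> sem \<alpha> \<and> gr (N, s) \<subseteq> prog_group \<alpha>"
    if "M \<in> max_ccS5 N" for M
    using wf that
  proof (induction M rule: wf_induct_rule)
    case (less M)
    have "M' \<in> max_ccS5 N" if "(M, M') \<in> G_edges N" for M'
      using that by (auto simp: G_edges_def)
    then show ?case using node_programs[OF \<Phi> less.prems] less.IH by blast
  qed
  then show ?thesis using ex_node[OF s] by blast
qed

end

theorem theorem3p9:
  fixes \<Phi> :: "('a, 'p) fm set"
    and N :: "('e, 'a, 'p) act_model"
    and s :: 'e
  assumes "(N, s) \<in> FAct \<Phi>"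
    and "finite_tree (G_nodes N) (G_edges N)"
  shows "basic_learning_action \<Phi> (N, s)"
proof -
  interpret acyclic_K45 N
    using assms finite_tree_acyclic by unfold_locales (auto simp: FAct_def)
  show ?thesis
    using assms(1) ex_program[of \<Phi> s] unfolding basic_learning_action_def FAct_def by auto
qed

end
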